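(* Let $X=N_{\mathbb R}/\Lambda$ be a real torus with integral structure of dimension $g$, with dual $\widehat X=\Lambda^*_{\mathbb R}/N^*$, and let $F_{E_X}:H^{\bullet,\bullet}(X)_{\mathbb Q}\to H^{\bullet,\bullet}(\widehat X)_{\mathbb Q}$ be the Fourier--Mukai transform on tropical cohomology. Then for all $p,q\ge 0$ the restriction of $F_{E_X}$ to integral tropical cohomology is an isomorphism of abelian groups $$F_{E_X}|_{H^{p,q}(X)}:H^{p,q}(X)\xrightarrow{\ \sim\ }H^{g-q,g-p}(\widehat X).$$
   Context: For a lattice (finitely generated free abelian group) $M$ write $M_{\mathbb R}=M\otimes_{\mathbb Z}\mathbb R$, $M^*=\mathrm{Hom}(M,\mathbb Z)$. A real torus with integral structure of dimension $g$ is $X=N_{\mathbb R}/\Lambda$, where $N$ is a lattice of rank $g$ (giving the integral affine structure) and $\Lambda\subset N_{\mathbb R}$ is a second lattice of full rank $g$, so $\Lambda_{\mathbb R}=N_{\mathbb R}$. Its dual is $\widehat X=\Lambda^*_{\mathbb R}/N^*$ (integral structure given by $\Lambda^*$, and $N^*\subset N^*_{\mathbb R}=\Lambda^*_{\mathbb R}$). Tropical cohomology: $H^{p,q}(X)=\bigwedge^q\Lambda^*\otimes\bigwedge^pN^*$, with cup product $(\alpha\otimes\omega)\smile(\beta\otimes\xi)=(\alpha\wedge\beta)\otimes(\omega\wedge\xi)$; hence $H^{p,q}(\widehat X)=\bigwedge^qN\otimes\bigwedge^p\Lambda$. The subscript $\mathbb Q$ means $\otimes_{\mathbb Z}\mathbb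 Q$. Choose bases $\{\lambda_i\}_{i=1}^g$ of $\Lambda$ and $\{\eta_i\}_{i=1}^g$ of $N$ inducing the same orientation of $N_{\mathbb R}$, with dual bases $\{\lambda_i^*\},\{\eta_i^*\}$. Let $\delta:H^{\bullet,\bullet}(X)\to H^{g,g}(X)\cong\mathbb Z$ be the projection onto bidegree $(g,g)$ followed by $(\lambda_1^*\wedge\dots\wedge\lambda_g^* )\otimes(\eta_1^*\wedge\dots\wedge\eta_g^* )\mapsto1$. By the Künneth theorem $H^{\bullet,\bullet}(X\times\widehat X)=H^{\bullet,\bullet}(X)\otimes H^{\bullet,\bullet}(\widehat X)$ (bidegrees add). The product is $(x\otimes y)\cdot(x'\otimes y')=(-1)^{|x||y'|}(x\smile x')\otimes(y\smile y')$, where $|\cdot|$ is the total degree $p+q$. Let $p_1,p_2$ be the projections of $X\times\widehat X$ to $X$ and $\widehat X$; then $p_1^*(x)=x\otimes1$ and $p_{2*}(x\otimes y)=\delta(x)\,y$. The tropical Poincaré bundle $\mathcal P_X$ on $X\times\widehat X$ has first Chern class $E_X:=c_1(\mathcal P_X)=-\sum_i\eta_i^*\otimes\eta_i-\sum_i\lambda_i^*\otimes\lambda_i$, where $\eta_i^*\in N^*=H^{1,0}(X)$, $\eta_i\in N=H^{0,1}(\widehat X)$, $\lambda_i^*\in\Lambda^*=H^{0,1}(X)$, $\lambda_i\in\Lambda=H^{1,0}(\widehat X)$. Put $e^{c_1(\mathcal P_X)}=\sum_{k\ge0}\frac1{k!}c_1(\mathcal P_X)^{k}$. The Fourier--Mukai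 transform is the homomorphism $F_{E_X}:H^{\bullet,\bullet}(X)_{\mathbb Q}\to H^{\bullet,\bullet}(\widehat X)_{\mathbb Q}$, $F_{E_X}(\alpha)=p_{2*}\big(e^{c_1(\mathcal P_X)}\cdot p_1^*\alpha\big)$. *)

theory Defs
  imports
    Complex_Main
    "HOL-Library.Poly_Mapping"
    "HOL-Library.Groups_Big_Fun"
    "HOL-Computational_Algebra.Group_Closure"
    "Jordan_Normal_Form.Determinant"
begin

section \<open>Abelian groups as modules over the integers\<close>

definition zmul :: "int \<Rightarrow> 'a::ab_group_add \<Rightarrow> 'a" where
  "zmul n x = (if 0 \<le> n then ((+) x ^^ nat n) 0 else - (((+) x ^^ nat (- n)) 0))"

lemma zmul_0 [simp]: "zmul 0 x = 0"
  by (simp add: zmul_def)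

lemma zmul_1 [simp]: "zmul 1 x = x"
  by (simp add: zmul_def)

lemma zmul_minus_left [simp]: "zmul (- n) x = - zmul n x"
  by (auto simp: zmul_def)

lemma zmul_plus1: "zmul (n + 1) x = x + zmul n x"
proof (cases "0 \<le> n")
  case True
  then have "nat (n + 1) = Suc (nat n)" by simp
  with True show ?thesis by (simp add: zmul_def)
next
  case False
  then have "nat (- n) = Suc (nat (- (n + 1)))" by simp
  with False show ?thesis
    by (cases "n = - 1") (auto simp: zmul_def algebra_simps)
qed

lemma zmul_minus1: "zmul (n - 1) x = zmul n x - x"
  using zmul_plus1[of "n - 1" x] by simp

lemma zmul_add_left: "zmul (m + n) x = zmul m x + zmul n x"
proof (induction m rule: int_induct[where k = 0])
  case (step1 i)
  have "i + 1 + n = (i + n) + 1" by simp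
  then show ?case using step1 by (simp only: zmul_plus1) (simp only: add.assoc)
next
  case (step2 i)
  have "i - 1 + n = (i + n) - 1" by simp
  then show ?case using step2 by (simp only: zmul_minus1) simp
qed simp

lemma zmul_add_right: "zmul n (x + y) = zmul n x + zmul n y"
  by (induction n rule: int_induct[where k = 0]) (simp_all add: zmul_plus1 zmul_minus1)

lemma additive_zmul: "additive (zmul n)"
  by unfold_locales (rule zmul_add_right)

lemma zmul_additive:
  assumes "additive f"
  shows "f (zmul n x) = zmul n (f x)"
proof -
  interpret additive f by fact
  show ?thesis
    by (induction n rule: int_induct[where k = 0])
      (simp_all add: zmul_plus1 zmul_minus1 zero add diff)
qed

lemma zmul_zero_right [simp]: "zmul n 0 = 0"
  using additive.zero[OF additive_zmul] .

lemma zmul_diff_left: "zmul (m - n) x = zmul m x - zmul n x"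
  using zmul_add_left[of m "- n" x] by simp

lemma zmul_zmul: "zmul m (zmul n x) = zmul (m * n) x"
  by (induction m rule: int_induct[where k = 0])
    (simp_all add: zmul_plus1 zmul_minus1 distrib_right left_diff_distrib zmul_add_left zmul_diff_left)

definition lattice_basis :: "nat \<Rightarrow> (nat \<Rightarrow> 'a::ab_group_add) \<Rightarrow> bool" where
  "lattice_basis g b \<longleftrightarrow>
     (\<forall>x. \<exists>!c :: nat \<Rightarrow> int. (\<forall>i\<ge>g. c i = 0) \<and> x = (\<Sum>i<g. zmul (c i) (b i)))"

definition biadditive :: "('a::ab_group_add \<Rightarrow> 'b::ab_group_add \<Rightarrow> 'c::ab_group_add) \<Rightarrow> bool" where
  "biadditive f \<longleftrightarrow> (\<forall>b. additive (\<lambda>a. f a b)) \<and> (\<forall>a. additive (f a))"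

lemma biadditiveI:
  assumes "\<And>a a' b. f (a + a') b = f a b + f a' b" and "\<And>a b b'. f a (b + b') = f a b + f a b'"
  shows "biadditive f"
  using assms by (auto simp: biadditive_def additive_def)

lemma biadditiveD:
  assumes "biadditive f"
  shows "f (a + a') b = f a b + f a' b" "f a (b + b') = f a b + f a b'"
    "f (a - a') b = f a b - f a' b" "f a (b - b') = f a b - f a b'"
    "f 0 b = 0" "f a 0 = 0" "f (- a) b = - f a b" "f a (- b) = - f a b"
  using assms additive.add[of "\<lambda>a. f a b"] additive.add[of "f a"]
    additive.diff[of "\<lambda>a. f a b"] additive.diff[of "f a"]
    additive.zero[of "\<lambda>a. f a b"] additive.zero[of "f a"]
    additive.minus[of "\<lambda>a. f a b"] additive.minus[of "f a"]
  by (auto simp: biadditive_def)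

lemma additive_group_closure:
  assumes "additive h" and "\<And>s. s \<in> S \<Longrightarrow> h s \<in> group_closure T" and "x \<in> group_closure S"
  shows "h x \<in> group_closure T"
  using assms(3)
proof induction
  case (base s)
  then show ?case using assms(2) additive.zero[OF assms(1)] by auto
next
  case (diff s t)
  then show ?case by (simp add: additive.diff[OF assms(1)] group_closure.diff)
qed

lemma group_closure_cong:
  assumes "u - u' \<in> group_closure S" "v - v' \<in> group_closure S"
  shows "(u + v) - (u' + v') \<in> group_closure S" "(u - v) - (u' - v') \<in> group_closure S"
    "- u - - u' \<in> group_closure S"
proof -
  have "(u + v) - (u' + v') = (u - u') + (v - v')" by simp
  then show "(u + v) - (u' + v') \<in> group_closure S"
    using assms by (simp only: group_closure_add)
  have "(u - v) - (u' - v') = (u - u') - (v - v')" by simp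
  then show "(u - v) - (u' - v') \<in> group_closure S"
    using assms by (simp only: group_closure.diff)
  have "- u - - u' = - (u - u')" by simp
  then show "- u - - u' \<in> group_closure S"
    using assms by (simp only: group_closure_minus_iff)
qed

lemma group_closure_mono: "S \<subseteq> T \<Longrightarrow> x \<in> group_closure S \<Longrightarrow> x \<in> group_closure T"
  by (rule additive_group_closure[of "\<lambda>x. x"]) (auto simp: additive_def intro: group_closure.base)

lemma additive_zero_on_group_closure:
  assumes "additive h" and "\<And>s. s \<in> S \<Longrightarrow> h s = 0" and "x \<in> group_closure S"
  shows "h x = 0"
  using additive_group_closure[of h S "{}" x] assms by auto


section \<open>The dual lattice\<close>

typedef (overloaded) 'a zdual = "{f :: 'a::ab_group_add \<Rightarrow> int. additive f}"
  morphisms zeval Abs_zdual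
  by (rule exI[of _ "\<lambda>_. 0"]) (simp add: additive_def)

setup_lifting type_definition_zdual

instantiation zdual :: (ab_group_add) ab_group_add
begin

lift_definition zero_zdual :: "'a zdual" is "\<lambda>_. 0"
  by (simp add: additive_def)

lift_definition plus_zdual :: "'a zdual \<Rightarrow> 'a zdual \<Rightarrow> 'a zdual" is "\<lambda>f g x. f x + g x"
  by (simp add: additive_def)

lift_definition minus_zdual :: "'a zdual \<Rightarrow> 'a zdual \<Rightarrow> 'a zdual" is "\<lambda>f g x. f x - g x"
  by (simp add: additive_def)

lift_definition uminus_zdual :: "'a zdual \<Rightarrow> 'a zdual" is "\<lambda>f x. - f x"
  by (simp add: additive_def)

instance
  by standard (transfer; simp add: fun_eq_iff)+

end

definition dual_basis :: "nat \<Rightarrow> (nat \<Rightarrow> 'a::ab_group_add) \<Rightarrow> nat \<Rightarrow> 'a zdual" where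
  "dual_basis g b i = (THE f. \<forall>k<g. zeval f (b k) = of_bool (i = k))"


section \<open>Tensor products of abelian groups\<close>

definition tensor_rels :: "('a::ab_group_add \<times> 'b::ab_group_add \<Rightarrow>\<^sub>0 int) set" where
  "tensor_rels =
     {frag_of (a + a', b) - frag_of (a, b) - frag_of (a', b) | a a' b. True} \<union>
     {frag_of (a, b + b') - frag_of (a, b) - frag_of (a, b') | a b b'. True}"

definition tensor_eq ::
  "('a::ab_group_add \<times> 'b::ab_group_add \<Rightarrow>\<^sub>0 int) \<Rightarrow> ('a \<times> 'b \<Rightarrow>\<^sub>0 int) \<Rightarrow> bool" where
  "tensor_eq u v \<longleftrightarrow> u - v \<in> group_closure tensor_rels"

lemma equivp_group_closure: "equivp (\<lambda>u v :: 'a::ab_group_add. u - v \<in> group_closure S)"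
proof (rule equivpI)
  show "reflp (\<lambda>u v. u - v \<in> group_closure S)"
    by (simp add: reflp_def)
  show "symp (\<lambda>u v. u - v \<in> group_closure S)"
    by (rule sympI) (metis group_closure_minus_iff minus_diff_eq)
  show "transp (\<lambda>u v. u - v \<in> group_closure S)"
    by (rule transpI) (metis group_closure_add diff_add_cancel add_diff_eq)
qed

quotient_type (overloaded) ('a, 'b) tensor =
  "('a::ab_group_add \<times> 'b::ab_group_add) \<Rightarrow>\<^sub>0 int" / tensor_eq
  by (rule equivp_group_closure[of tensor_rels, folded tensor_eq_def[abs_def]])

instantiation tensor :: (ab_group_add, ab_group_add) ab_group_add
begin

lift_definition zero_tensor :: "('a, 'b) tensor" is 0 .

lift_definition plus_tensor :: "('a, 'b) tensor \<Rightarrow> ('a, 'b) tensor \<Rightarrow> ('a, 'b) tensor" is "(+)"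
  unfolding tensor_eq_def by (rule group_closure_cong)

lift_definition uminus_tensor :: "('a, 'b) tensor \<Rightarrow> ('a, 'b) tensor" is "uminus"
  unfolding tensor_eq_def by (rule group_closure_cong)

lift_definition minus_tensor :: "('a, 'b) tensor \<Rightarrow> ('a, 'b) tensor \<Rightarrow> ('a, 'b) tensor" is "(-)"
  unfolding tensor_eq_def
  by (rule group_closure_cong)

instance
  by standard (transfer; simp add: tensor_eq_def)+

end

lift_definition tens :: "'a::ab_group_add \<Rightarrow> 'b::ab_group_add \<Rightarrow> ('a, 'b) tensor"
    (infixl \<open>\<otimes>\<^sub>Z\<close> 75)
  is "\<lambda>a b. frag_of (a, b)" .

lemma biadditive_tens: "biadditive (\<otimes>\<^sub>Z)"
proof (rule biadditiveI)
  fix a a' :: 'a and b b' :: 'b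
  show "(a + a') \<otimes>\<^sub>Z b = a \<otimes>\<^sub>Z b + a' \<otimes>\<^sub>Z b"
    by transfer (unfold tensor_eq_def tensor_rels_def diff_diff_eq[symmetric], rule group_closure.base, blast)
  show "a \<otimes>\<^sub>Z (b + b') = a \<otimes>\<^sub>Z b + a \<otimes>\<^sub>Z b'"
    by transfer (unfold tensor_eq_def tensor_rels_def diff_diff_eq[symmetric], rule group_closure.base, blast)
qed

lemmas tens_simps = biadditiveD[OF biadditive_tens]

definition free_lift :: "('x \<Rightarrow> 'c::ab_group_add) \<Rightarrow> ('x \<Rightarrow>\<^sub>0 int) \<Rightarrow> 'c" where
  "free_lift f u = (\<Sum>x\<in>Poly_Mapping.keys u. zmul (Poly_Mapping.lookup u x) (f x))"

lemma free_lift_superset: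
  assumes "finite A" "Poly_Mapping.keys u \<subseteq> A"
  shows "free_lift f u = (\<Sum>x\<in>A. zmul (Poly_Mapping.lookup u x) (f x))"
  unfolding free_lift_def using assms
  by (intro sum.mono_neutral_left) (auto simp: in_keys_iff)

lemma additive_free_lift: "additive (free_lift f)"
proof
  fix u v :: "'a \<Rightarrow>\<^sub>0 int"
  let ?A = "Poly_Mapping.keys u \<union> Poly_Mapping.keys v"
  have "Poly_Mapping.keys (u + v) \<subseteq> ?A" by (rule Poly_Mapping.keys_add)
  then show "free_lift f (u + v) = free_lift f u + free_lift f v"
    by (simp add: free_lift_superset[of ?A] lookup_add zmul_add_left sum.distrib)
qed

lemma free_lift_of [simp]: "free_lift f (frag_of x) = f x"
  by (simp add: free_lift_def)

definition tensor_lift ::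
  "('a::ab_group_add \<Rightarrow> 'b::ab_group_add \<Rightarrow> 'c::ab_group_add) \<Rightarrow> ('a, 'b) tensor \<Rightarrow> 'c" where
  \<comment> \<open>The additive map with \<open>a \<otimes>\<^sub>Z b \<mapsto> f a b\<close>; only meaningful for biadditive \<open>f\<close>, where the
    choice of a representative is immaterial.\<close>
  "tensor_lift f t = free_lift (\<lambda>(a, b). f a b) (rep_tensor t)"

lemma tensor_lift_abs:
  assumes "biadditive f"
  shows "tensor_lift f (abs_tensor u) = free_lift (\<lambda>(a, b). f a b) u"
proof -
  have "tensor_eq (rep_tensor (abs_tensor u)) u"
    by (rule Quotient3_rep_abs[OF Quotient3_tensor])
      (simp add: tensor_eq_def)
  then have "free_lift (\<lambda>(a, b). f a b) (rep_tensor (abs_tensor u) - u) = 0"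
    unfolding tensor_eq_def
    by (rule additive_zero_on_group_closure[OF additive_free_lift, rotated])
      (auto simp: tensor_rels_def additive.diff[OF additive_free_lift] biadditiveD[OF assms])
  then show ?thesis
    by (simp add: tensor_lift_def additive.diff[OF additive_free_lift])
qed

lemma tensor_lift_tens [simp]: "biadditive f \<Longrightarrow> tensor_lift f (a \<otimes>\<^sub>Z b) = f a b"
  by (simp add: tens.abs_eq tensor_lift_abs)

lemma additive_tensor_lift:
  assumes "biadditive f"
  shows "additive (tensor_lift f)"
proof
  fix s t :: "('a, 'b) tensor"
  obtain u v where "s = abs_tensor u" "t = abs_tensor v"
    by (metis Quotient3_abs_rep Quotient3_tensor)
  then show "tensor_lift f (s + t) = tensor_lift f s + tensor_lift f t"
    by (simp add: plus_tensor.abs_eq tensor_lift_abs assms additive.add[OF additive_free_lift])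
qed

lemma frag_induct [case_names zero of diff]:
  assumes "P 0" "\<And>x. P (frag_of x)" "\<And>u v. P u \<Longrightarrow> P v \<Longrightarrow> P (u - v)"
  shows "P u"
  by (rule frag_induction[of u UNIV]) (use assms in auto)

lemma tensor_induct [case_names tens diff, induct type: tensor]:
  assumes "\<And>a b. P (a \<otimes>\<^sub>Z b)" and "\<And>s t. P s \<Longrightarrow> P t \<Longrightarrow> P (s - t)"
  shows "P t"
proof -
  obtain u where t: "t = abs_tensor u"
    by (metis Quotient3_abs_rep Quotient3_tensor)
  have "P (abs_tensor u)"
  proof (induction u rule: frag_induct)
    case zero
    show ?case using assms(1)[of 0 0] by (simp add: tens_simps zero_tensor_def)
  next
    case (of x)
    show ?case using assms(1)[of "fst x" "snd x"] by (simp add: tens.abs_eq)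
  next
    case (diff u v)
    then show ?case using assms(2)[OF diff] by (simp add: minus_tensor.abs_eq)
  qed
  with t show ?thesis by simp
qed

lemma tensor_additive_eqI:
  assumes "additive f" "additive h" "\<And>a b. f (a \<otimes>\<^sub>Z b) = h (a \<otimes>\<^sub>Z b)"
  shows "f t = h t"
  by (induction t) (simp_all add: assms additive.diff)

definition tensor_map :: "('a::ab_group_add \<Rightarrow> 'c::ab_group_add) \<Rightarrow> ('b::ab_group_add \<Rightarrow> 'd::ab_group_add)
    \<Rightarrow> ('a, 'b) tensor \<Rightarrow> ('c, 'd) tensor" where
  "tensor_map f h = tensor_lift (\<lambda>a b. f a \<otimes>\<^sub>Z h b)"

lemma biadditive_tensor_map:
  "additive f \<Longrightarrow> additive h \<Longrightarrow> biadditive (\<lambda>a b. f a \<otimes>\<^sub>Z h b)"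
  by (rule biadditiveI) (simp_all add: additive.add tens_simps)

lemma tensor_map_tens [simp]:
  "additive f \<Longrightarrow> additive h \<Longrightarrow> tensor_map f h (a \<otimes>\<^sub>Z b) = f a \<otimes>\<^sub>Z h b"
  by (simp add: tensor_map_def biadditive_tensor_map)

lemma additive_tensor_map:
  "additive f \<Longrightarrow> additive h \<Longrightarrow> additive (tensor_map f h)"
  unfolding tensor_map_def by (intro additive_tensor_lift biadditive_tensor_map)

lemma additive_id: "additive (\<lambda>x. x)"
  by (simp add: additive_def)

text \<open>The real vector space \<open>M\<^sub>\<real>\<close> of a lattice \<open>M\<close> is \<open>(M, real) tensor\<close>.\<close>

instantiation tensor :: (ab_group_add, real_vector) real_vector
begin

definition scaleR_tensor :: "real \<Rightarrow> ('a, 'b) tensor \<Rightarrow> ('a, 'b) tensor" where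
  "scaleR_tensor r = tensor_map (\<lambda>x. x) (scaleR r)"

instance
proof
  fix r s :: real and x y :: "('a, 'b) tensor"
  have a: "additive (scaleR r :: 'b \<Rightarrow> 'b)" for r
    by (simp add: additive_def scaleR_add_right)
  have A: "additive (scaleR r :: ('a, 'b) tensor \<Rightarrow> _)" for r
    unfolding scaleR_tensor_def by (intro additive_tensor_map additive_id a)
  have T: "r *\<^sub>R (m \<otimes>\<^sub>Z v) = m \<otimes>\<^sub>Z (r *\<^sub>R v)" for r and m :: 'a and v :: 'b
    by (simp add: scaleR_tensor_def additive_id a)
  show "r *\<^sub>R (x + y) = r *\<^sub>R x + r *\<^sub>R y" by (rule additive.add[OF A])
  show "(r + s) *\<^sub>R x = r *\<^sub>R x + s *\<^sub>R x"
    by (induction x) (simp_all add: T additive.diff[OF A] tens_simps scaleR_add_left)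
  show "r *\<^sub>R s *\<^sub>R x = (r * s) *\<^sub>R x"
    by (induction x) (simp_all add: T additive.diff[OF A])
  show "1 *\<^sub>R x = x"
    by (induction x) (simp_all add: T additive.diff[OF A])
qed

end

definition tens_mult :: "'a::ring \<Rightarrow> 'b::ring \<Rightarrow> 'a \<Rightarrow> 'b \<Rightarrow> ('a, 'b) tensor" where
  "tens_mult a b a' b' = (a * a') \<otimes>\<^sub>Z (b * b')"

lemma biadditive_tens_mult: "biadditive (tens_mult a b)"
  by (rule biadditiveI) (simp_all add: tens_mult_def distrib_left tens_simps)

lemma biadditive_tens_mult_lift: "biadditive (\<lambda>a b. tensor_lift (tens_mult a b) t)"
proof (rule biadditiveI)
  note [simp] = biadditive_tens_mult additive.diff[OF additive_tensor_lift[OF biadditive_tens_mult]]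
  show "tensor_lift (tens_mult (a + a') b) t = tensor_lift (tens_mult a b) t + tensor_lift (tens_mult a' b) t"
    for a a' b
    by (induction t) (simp_all, simp add: tens_mult_def distrib_right tens_simps)
  show "tensor_lift (tens_mult a (b + b')) t = tensor_lift (tens_mult a b) t + tensor_lift (tens_mult a b') t"
    for a b b'
    by (induction t) (simp_all, simp add: tens_mult_def distrib_right tens_simps)
qed

instantiation tensor :: (ring, ring) ring
begin

definition times_tensor :: "('a, 'b) tensor \<Rightarrow> ('a, 'b) tensor \<Rightarrow> ('a, 'b) tensor" where
  "s * t = tensor_lift (\<lambda>a b. tensor_lift (tens_mult a b) t) s"

lemma times_tens_left: "(a \<otimes>\<^sub>Z b) * t = tensor_lift (tens_mult a b) t" for a :: 'a and b :: 'b
  unfolding times_tensor_def by (rule tensor_lift_tens[OF biadditive_tens_mult_lift])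

lemma times_tens: "(a \<otimes>\<^sub>Z b) * (a' \<otimes>\<^sub>Z b') = (a * a') \<otimes>\<^sub>Z (b * b')" for a a' :: 'a and b b' :: 'b
  by (simp add: times_tens_left biadditive_tens_mult) (simp add: tens_mult_def)

lemma biadditive_times_tensor: "biadditive ((*) :: ('a, 'b) tensor \<Rightarrow> _)"
proof (rule biadditiveI)
  fix s s' t t' :: "('a, 'b) tensor"
  show "(s + s') * t = s * t + s' * t"
    unfolding times_tensor_def by (rule additive.add[OF additive_tensor_lift[OF biadditive_tens_mult_lift]])
  show "s * (t + t') = s * t + s * t'"
  proof (induction s)
    case (tens a b)
    show ?case
      by (simp add: times_tens_left additive.add[OF additive_tensor_lift[OF biadditive_tens_mult]])
  next
    case (diff s s')
    have "(s - s') * u = s * u - s' * u" for u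
      unfolding times_tensor_def
      by (rule additive.diff[OF additive_tensor_lift[OF biadditive_tens_mult_lift]])
    with diff show ?case by simp
  qed
qed

instance
proof
  note B = biadditiveD[OF biadditive_times_tensor]
  fix r s t :: "('a, 'b) tensor"
  show "(r + s) * t = r * t + s * t" "r * (s + t) = r * s + r * t"
    by (rule B)+
  show "r * s * t = r * (s * t)"
  proof (induction r)
    case (tens a b)
    show ?case
    proof (induction s)
      case (tens a' b')
      show ?case by (induction t) (simp_all add: B times_tens mult.assoc)
    qed (simp add: B)
  qed (simp add: B)
qed

end

instantiation tensor :: (ring_1, ring_1) one
begin
definition one_tensor :: "('a, 'b) tensor" where "one_tensor = 1 \<otimes>\<^sub>Z 1"
instance ..
end

instance tensor :: (ring_1, ring_1) monoid_mult
proof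
  fix t :: "('a, 'b) tensor"
  note B = biadditiveD[OF biadditive_times_tensor]
  show "1 * t = t"
    by (induction t) (simp_all add: one_tensor_def B times_tens)
  show "t * 1 = t"
    by (induction t) (simp_all add: one_tensor_def B times_tens)
qed


section \<open>The exterior algebra of an abelian group\<close>

text \<open>
  A word \<open>[a\<^sub>1, \<dots>, a\<^sub>k]\<close> stands for \<open>a\<^sub>1 \<and> \<dots> \<and> a\<^sub>k\<close>.  Since the relations are stated with arbitrary
  left and right contexts, the subgroup they generate is a two-sided ideal of the free ring on
  the underlying set; dividing by the first family alone gives the tensor algebra.
\<close>

definition ext_rels :: "('a::ab_group_add list \<Rightarrow>\<^sub>0 int) set" where
  "ext_rels =
     {frag_of (xs @ [a + b] @ ys) - frag_of (xs @ [a] @ ys) - frag_of (xs @ [b] @ ys) | xs a b ys. True} \<union>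
     {frag_of (xs @ [a, a] @ ys) | xs a ys. True}"

lemma ext_rels_add:
  "frag_of (xs @ [a + b] @ ys) - frag_of (xs @ [a] @ ys) - frag_of (xs @ [b] @ ys) \<in> ext_rels"
  unfolding ext_rels_def by blast

lemma ext_rels_square: "frag_of (xs @ [a, a] @ ys) \<in> ext_rels"
  unfolding ext_rels_def by blast

lemma ext_rels_cases:
  assumes "u \<in> ext_rels"
  obtains (add) xs a b ys where
      "u = frag_of (xs @ [a + b] @ ys) - frag_of (xs @ [a] @ ys) - frag_of (xs @ [b] @ ys)"
    | (square) xs a ys where "u = frag_of (xs @ [a, a] @ ys)"
  using assms unfolding ext_rels_def by blast

definition ext_eq :: "('a::ab_group_add list \<Rightarrow>\<^sub>0 int) \<Rightarrow> ('a list \<Rightarrow>\<^sub>0 int) \<Rightarrow> bool" where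
  "ext_eq u v \<longleftrightarrow> u - v \<in> group_closure ext_rels"

quotient_type (overloaded) 'a ext = "('a::ab_group_add list) \<Rightarrow>\<^sub>0 int" / ext_eq
  by (rule equivp_group_closure[of ext_rels, folded ext_eq_def[abs_def]])

definition word_mult :: "('a list \<Rightarrow>\<^sub>0 int) \<Rightarrow> ('a list \<Rightarrow>\<^sub>0 int) \<Rightarrow> ('a list \<Rightarrow>\<^sub>0 int)" where
  "word_mult u v = frag_extend (\<lambda>xs. frag_extend (\<lambda>ys. frag_of (xs @ ys)) v) u"

lemma additive_frag_extend: "additive (frag_extend f)"
  by (simp add: additive_def frag_extend_add)

lemma word_mult_add_left: "word_mult (u + u') v = word_mult u v + word_mult u' v"
  by (simp add: word_mult_def frag_extend_add)

lemma word_mult_diff_left: "word_mult (u - u') v = word_mult u v - word_mult u' v"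
  by (simp add: word_mult_def frag_extend_diff)

lemma word_mult_of: "word_mult (frag_of xs) v = frag_extend (\<lambda>ys. frag_of (xs @ ys)) v"
  by (simp add: word_mult_def)

lemma word_mult_of_of [simp]: "word_mult (frag_of xs) (frag_of ys) = frag_of (xs @ ys)"
  by (simp add: word_mult_def)

lemma word_mult_zero [simp]: "word_mult 0 v = 0"
  by (simp add: word_mult_def)

lemma word_mult_diff_right: "word_mult u (v - v') = word_mult u v - word_mult u v'"
  by (induction u rule: frag_induct) (simp_all add: word_mult_diff_left word_mult_of frag_extend_diff)

lemma word_mult_add_right: "word_mult u (v + v') = word_mult u v + word_mult u v'"
  by (induction u rule: frag_induct) (simp_all add: word_mult_diff_left word_mult_of frag_extend_add)

lemma word_mult_zero_right [simp]: "word_mult u 0 = 0"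
  using word_mult_diff_right[of u 0 0] by simp

lemma word_mult_assoc: "word_mult (word_mult u v) w = word_mult u (word_mult v w)"
proof (induction u rule: frag_induct)
  case (of xs)
  show ?case
  proof (induction v rule: frag_induct)
    case (of ys)
    show ?case
      by (induction w rule: frag_induct) (simp_all add: word_mult_diff_right)
  qed (simp_all add: word_mult_diff_left word_mult_diff_right)
qed (simp_all add: word_mult_diff_left)

lemma word_mult_rels_right:
  assumes "v \<in> group_closure ext_rels"
  shows "word_mult u v \<in> group_closure ext_rels"
proof (induction u rule: frag_induct)
  case (of xs)
  show ?case
  proof (rule additive_group_closure[OF _ _ assms])
    show "additive (word_mult (frag_of xs))"
      by (simp add: additive_def word_mult_add_right)
    fix s :: "'a list \<Rightarrow>\<^sub>0 int"
    assume "s \<in> ext_rels"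
    then have "word_mult (frag_of xs) s \<in> ext_rels"
    proof (cases rule: ext_rels_cases)
      case (add as a b bs)
      then show ?thesis
        using ext_rels_add[of "xs @ as" a b bs] by (simp add: word_mult_diff_right)
    next
      case (square as a bs)
      then show ?thesis using ext_rels_square[of "xs @ as" a bs] by simp
    qed
    then show "word_mult (frag_of xs) s \<in> group_closure ext_rels"
      by (intro group_closure.base insertI2)
  qed
qed (simp_all add: word_mult_diff_left group_closure.diff)

lemma word_mult_rels_left:
  assumes "u \<in> group_closure ext_rels"
  shows "word_mult u v \<in> group_closure ext_rels"
proof (induction v rule: frag_induct)
  case (of ys)
  show ?case
  proof (rule additive_group_closure[OF _ _ assms])
    show "additive (\<lambda>u. word_mult u (frag_of ys))"
      by (simp add: additive_def word_mult_add_left)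
    fix s :: "'a list \<Rightarrow>\<^sub>0 int"
    assume "s \<in> ext_rels"
    then have "word_mult s (frag_of ys) \<in> ext_rels"
    proof (cases rule: ext_rels_cases)
      case (add as a b bs)
      then show ?thesis
        using ext_rels_add[of as a b "bs @ ys"] by (simp add: word_mult_diff_left)
    next
      case (square as a bs)
      then show ?thesis using ext_rels_square[of as a "bs @ ys"] by simp
    qed
    then show "word_mult s (frag_of ys) \<in> group_closure ext_rels"
      by (intro group_closure.base insertI2)
  qed
qed (simp_all add: word_mult_diff_right group_closure.diff)

lemma one_notin_ext_rels: "frag_of [] \<notin> group_closure ext_rels"
proof
  assume "frag_of [] \<in> group_closure (ext_rels :: ('a::ab_group_add list \<Rightarrow>\<^sub>0 int) set)"
  then have "Poly_Mapping.lookup (frag_of ([] :: 'a list)) [] = 0"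
    by (rule additive_zero_on_group_closure[rotated 2])
      (auto simp: additive_def lookup_add lookup_minus ext_rels_def)
  then show False by simp
qed

instantiation ext :: (ab_group_add) ring_1
begin

lift_definition zero_ext :: "'a ext" is 0 .

lift_definition one_ext :: "'a ext" is "frag_of []" .

lift_definition plus_ext :: "'a ext \<Rightarrow> 'a ext \<Rightarrow> 'a ext" is "(+)"
  unfolding ext_eq_def by (rule group_closure_cong)

lift_definition uminus_ext :: "'a ext \<Rightarrow> 'a ext" is "uminus"
  unfolding ext_eq_def by (rule group_closure_cong)

lift_definition minus_ext :: "'a ext \<Rightarrow> 'a ext \<Rightarrow> 'a ext" is "(-)"
  unfolding ext_eq_def
  by (rule group_closure_cong)

lift_definition times_ext :: "'a ext \<Rightarrow> 'a ext \<Rightarrow> 'a ext" is word_mult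
proof -
  fix u u' v v' :: "'a list \<Rightarrow>\<^sub>0 int"
  assume "ext_eq u u'" "ext_eq v v'"
  then have "word_mult (u - u') v + word_mult u' (v - v') \<in> group_closure ext_rels"
    unfolding ext_eq_def by (intro group_closure_add word_mult_rels_left word_mult_rels_right)
  then show "ext_eq (word_mult u v) (word_mult u' v')"
    by (simp add: ext_eq_def word_mult_diff_left word_mult_diff_right)
qed

instance
proof
  have one_left: "word_mult (frag_of []) u = u" for u :: "'a list \<Rightarrow>\<^sub>0 int"
    by (induction u rule: frag_induct) (simp_all add: word_mult_diff_right)
  have one_right: "word_mult u (frag_of []) = u" for u :: "'a list \<Rightarrow>\<^sub>0 int"
    by (induction u rule: frag_induct) (simp_all add: word_mult_diff_left)
  fix a b c :: "'a ext"
  show "a + b + c = a + (b + c)" "a + b = b + a" "0 + a = a" "- a + a = 0" "a - b = a + - b"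
    by (transfer; simp add: ext_eq_def)+
  show "a * b * c = a * (b * c)" by transfer (simp add: word_mult_assoc ext_eq_def)
  show "1 * a = a" by transfer (simp add: one_left ext_eq_def)
  show "a * 1 = a" by transfer (simp add: one_right ext_eq_def)
  show "(a + b) * c = a * c + b * c" by transfer (simp add: word_mult_add_left ext_eq_def)
  show "a * (b + c) = a * b + a * c" by transfer (simp add: word_mult_add_right ext_eq_def)
  show "(0 :: 'a ext) \<noteq> 1"
    by transfer (use one_notin_ext_rels in \<open>auto simp: ext_eq_def\<close>)
qed

end

lift_definition ext_of :: "'a::ab_group_add \<Rightarrow> 'a ext" is "\<lambda>a. frag_of [a]" .

definition wedge :: "'a::ab_group_add list \<Rightarrow> 'a ext" where
  "wedge xs = prod_list (map ext_of xs)"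

lemma wedge_abs: "wedge xs = abs_ext (frag_of xs)"
  by (induction xs) (simp_all add: wedge_def one_ext.abs_eq ext_of.abs_eq times_ext.abs_eq)

lemma ext_induct [case_names wedge diff, induct type: ext]:
  assumes "\<And>xs. P (wedge xs)" and "\<And>x y. P x \<Longrightarrow> P y \<Longrightarrow> P (x - y)"
  shows "P x"
proof -
  obtain u where x: "x = abs_ext u"
    by (metis Quotient3_abs_rep Quotient3_ext)
  have "P (abs_ext u)"
  proof (induction u rule: frag_induct)
    case zero
    show ?case using assms(2)[OF assms(1)[of "[]"] assms(1)[of "[]"]] by (simp add: zero_ext_def)
  next
    case (of xs)
    show ?case using assms(1)[of xs] by (simp add: wedge_abs)
  next
    case (diff u v)
    then show ?case using assms(2)[OF diff] by (simp add: minus_ext.abs_eq)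
  qed
  with x show ?thesis by simp
qed

text \<open>Degrees are integers so that \<open>\<And>\<^sup>k\<close> vanishes for negative \<open>k\<close>.\<close>

definition ext_power :: "int \<Rightarrow> 'a::ab_group_add ext set" where
  "ext_power k = group_closure {wedge xs | xs. int (length xs) = k}"

lift_definition ext_proj :: "nat \<Rightarrow> 'a::ab_group_add ext \<Rightarrow> 'a ext"
  is "\<lambda>k. frag_extend (\<lambda>xs. if length xs = k then frag_of xs else 0)"
proof -
  fix k and u v :: "'a list \<Rightarrow>\<^sub>0 int"
  let ?h = "frag_extend (\<lambda>xs :: 'a list. if length xs = k then frag_of xs else 0)"
  assume "ext_eq u v"
  then have "?h (u - v) \<in> group_closure ext_rels"
    unfolding ext_eq_def
  proof (rule additive_group_closure[OF additive_frag_extend, rotated])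
    fix s :: "'a list \<Rightarrow>\<^sub>0 int"
    assume s: "s \<in> ext_rels"
    then have "?h s = s \<or> ?h s = 0"
      by (auto simp: ext_rels_def frag_extend_diff split: if_splits)
    moreover have "s \<in> group_closure ext_rels"
      using s by (intro group_closure.base insertI2)
    ultimately show "?h s \<in> group_closure ext_rels"
      by (auto simp only: zero_in_group_closure)
  qed
  then show "ext_eq (?h u) (?h v)"
    by (simp add: ext_eq_def frag_extend_diff)
qed

lemma additive_ext_proj: "additive (ext_proj k)"
proof
  fix x y :: "'a ext"
  show "ext_proj k (x + y) = ext_proj k x + ext_proj k y"
    by transfer (simp add: frag_extend_add ext_eq_def)
qed

lemma ext_proj_wedge: "ext_proj k (wedge xs) = (if length xs = k then wedge xs else 0)"
  by (simp add: wedge_abs ext_proj.abs_eq zero_ext.abs_eq)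


section \<open>Tropical cohomology\<close>

text \<open>
  The cohomology of a torus enters through the pair of lattices it is built from: bidegree
  \<open>(p, q)\<close> of \<open>('a, 'b) coh\<close> is \<open>\<And>\<^sup>q 'a \<otimes> \<And>\<^sup>p 'b\<close>.  For \<open>X = N\<^sub>\<real> / \<Lambda>\<close> the pair is \<open>(\<Lambda>\<^sup>*, N\<^sup>*)\<close>, for
  the dual torus it is \<open>(N, \<Lambda>)\<close>.  The cup product is the ring multiplication of \<open>tensor\<close>.
\<close>

type_synonym ('a, 'b) coh = "('a ext, 'b ext) tensor"

definition trop_coh :: "int \<Rightarrow> int \<Rightarrow> ('a::ab_group_add, 'b::ab_group_add) coh set" where
  "trop_coh p q = group_closure {\<alpha> \<otimes>\<^sub>Z \<omega> | \<alpha> \<omega>. \<alpha> \<in> ext_power q \<and> \<omega> \<in> ext_power p}"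

definition coh_proj :: "nat \<Rightarrow> nat \<Rightarrow> ('a::ab_group_add, 'b::ab_group_add) coh \<Rightarrow> ('a, 'b) coh" where
  "coh_proj p q = tensor_map (ext_proj q) (ext_proj p)"

lemma additive_coh_proj: "additive (coh_proj p q)"
  unfolding coh_proj_def by (intro additive_tensor_map additive_ext_proj)

lemma ext_proj_ext_power:
  assumes "x \<in> ext_power k"
  shows "ext_proj l x = (if int l = k then x else 0)"
  using assms unfolding ext_power_def
proof induction
  case (base s)
  then show ?case by (auto simp: ext_proj_wedge additive.zero[OF additive_ext_proj])
qed (simp add: additive.diff[OF additive_ext_proj])

lemma coh_proj_trop_coh:
  assumes "x \<in> trop_coh p q"
  shows "coh_proj p' q' x = (if int p' = p \<and> int q' = q then x else 0)"
  using assms unfolding trop_coh_def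
proof induction
  case (base s)
  then show ?case
    by (auto simp: coh_proj_def additive_ext_proj ext_proj_ext_power tens_simps
        additive.zero[OF additive_coh_proj, unfolded coh_proj_def])
qed (simp add: additive.diff[OF additive_coh_proj])

lemma finite_ext_proj: "finite {k. ext_proj k x \<noteq> 0}"
proof (induction x)
  case (wedge xs)
  have "{k. ext_proj k (wedge xs) \<noteq> 0} \<subseteq> {length xs}"
    by (auto simp: ext_proj_wedge split: if_splits)
  then show ?case by (rule finite_subset) simp
next
  case (diff x y)
  have "{k. ext_proj k (x - y) \<noteq> 0} \<subseteq> {k. ext_proj k x \<noteq> 0} \<union> {k. ext_proj k y \<noteq> 0}"
    by (auto simp: additive.diff[OF additive_ext_proj])
  then show ?case using diff by (meson finite_UnI finite_subset)
qed

lemma finite_coh_proj: "finite {(p, q). coh_proj p q x \<noteq> 0}"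
proof (induction x)
  case (tens a b)
  have "{(p, q). coh_proj p q (a \<otimes>\<^sub>Z b) \<noteq> 0} \<subseteq> {k. ext_proj k b \<noteq> 0} \<times> {k. ext_proj k a \<noteq> 0}"
    by (auto simp: coh_proj_def additive_ext_proj tens_simps)
  then show ?case by (rule finite_subset) (simp add: finite_ext_proj)
next
  case (diff x y)
  have "{(p, q). coh_proj p q (x - y) \<noteq> 0}
    \<subseteq> {(p, q). coh_proj p q x \<noteq> 0} \<union> {(p, q). coh_proj p q y \<noteq> 0}"
    by (auto simp: additive.diff[OF additive_coh_proj])
  then show ?case using diff by (meson finite_UnI finite_subset)
qed


section \<open>The product on the cohomology of a product of tori\<close>

text \<open>
  On the Kuenneth tensor product the ring multiplication of \<open>tensor\<close> is \<^emph>\<open>not\<close> the right one, as it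
  has no sign.  \<open>kunneth_mult\<close> is the biadditive extension of
  \<open>(x \<otimes> y) \<cdot> (x' \<otimes> y') = (-1)\<^bsup>|x| |y'|\<^esup> (x \<smile> x') \<otimes> (y \<smile> y')\<close>, obtained by splitting \<open>x\<close> and
  \<open>y'\<close> into homogeneous components; cf. the lemma \<open>kunneth_mult_homogeneous\<close> below.
\<close>


definition signed_tens :: "('a::ab_group_add, 'b::ab_group_add) coh \<Rightarrow> ('c::ab_group_add, 'd::ab_group_add) coh
    \<Rightarrow> ('a, 'b) coh \<Rightarrow> ('c, 'd) coh \<Rightarrow> (('a, 'b) coh, ('c, 'd) coh) tensor" where
  "signed_tens x y x' y' = Sum_any (\<lambda>(p, q, p', q').
     zmul ((-1) ^ ((p + q) * (p' + q'))) ((coh_proj p q x * x') \<otimes>\<^sub>Z (y * coh_proj p' q' y')))"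

definition kunneth_mult ::
  "(('a::ab_group_add, 'b::ab_group_add) coh, ('c::ab_group_add, 'd::ab_group_add) coh) tensor
    \<Rightarrow> (('a, 'b) coh, ('c, 'd) coh) tensor \<Rightarrow> (('a, 'b) coh, ('c, 'd) coh) tensor" where
  "kunneth_mult u v = tensor_lift (\<lambda>x y. tensor_lift (signed_tens x y) v) u"

lemma signed_tens_finite:
  assumes "finite A" "{(p, q, p', q'). coh_proj p q x \<noteq> 0 \<and> coh_proj p' q' y' \<noteq> 0} \<subseteq> A"
  shows "signed_tens x y x' y' = (\<Sum>(p, q, p', q')\<in>A.
     zmul ((-1) ^ ((p + q) * (p' + q'))) ((coh_proj p q x * x') \<otimes>\<^sub>Z (y * coh_proj p' q' y')))"
  unfolding signed_tens_def
proof (rule Sum_any.expand_superset[OF assms(1)], rule subsetI)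
  fix i
  assume i: "i \<in> {i. (case i of (p, q, p', q') \<Rightarrow>
     zmul ((-1) ^ ((p + q) * (p' + q'))) ((coh_proj p q x * x') \<otimes>\<^sub>Z (y * coh_proj p' q' y'))) \<noteq> 0}"
  obtain p q p' q' where [simp]: "i = (p, q, p', q')" by (metis prod_cases4)
  have "coh_proj p q x \<noteq> 0" "coh_proj p' q' y' \<noteq> 0"
    using i by (auto simp: tens_simps)
  then show "i \<in> A" using assms(2) by auto
qed

lemma finite_signed_tens_support:
  "finite {(p, q, p', q'). coh_proj p q x \<noteq> 0 \<and> coh_proj p' q' y' \<noteq> 0}"
proof (rule finite_subset)
  let ?S = "{(p, q). coh_proj p q x \<noteq> 0} \<times> {(p, q). coh_proj p q y' \<noteq> 0}"
  show "finite ((\<lambda>((p, q), (p', q')). (p, q, p', q')) ` ?S)"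
    by (intro finite_imageI finite_cartesian_product finite_coh_proj)
  show "{(p, q, p', q'). coh_proj p q x \<noteq> 0 \<and> coh_proj p' q' y' \<noteq> 0}
      \<subseteq> (\<lambda>((p, q), (p', q')). (p, q, p', q')) ` ?S"
    by (force simp: image_iff)
qed

lemma signed_tens_add:
  "signed_tens (x1 + x2) y x' y' = signed_tens x1 y x' y' + signed_tens x2 y x' y'"
  "signed_tens x (y1 + y2) x' y' = signed_tens x y1 x' y' + signed_tens x y2 x' y'"
  "signed_tens x y (x1' + x2') y' = signed_tens x y x1' y' + signed_tens x y x2' y'"
  "signed_tens x y x' (y1' + y2') = signed_tens x y x' y1' + signed_tens x y x' y2'"
proof -
  let ?s = "\<lambda>x y'. {(p, q, p', q'). coh_proj p q x \<noteq> 0 \<and> coh_proj p' q' y' \<noteq> 0}"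
  note simps = additive.add[OF additive_coh_proj] distrib_left distrib_right tens_simps zmul_add_right
    sum.distrib case_prod_unfold
  have "finite (?s x1 y' \<union> ?s x2 y')"
    by (intro finite_UnI finite_signed_tens_support)
  then show "signed_tens (x1 + x2) y x' y' = signed_tens x1 y x' y' + signed_tens x2 y x' y'"
    by (subst (1 2 3) signed_tens_finite[of "?s x1 y' \<union> ?s x2 y'"])
      (auto simp: additive.add[OF additive_coh_proj], simp add: simps)
  have "finite (?s x y1' \<union> ?s x y2')"
    by (intro finite_UnI finite_signed_tens_support)
  then show "signed_tens x y x' (y1' + y2') = signed_tens x y x' y1' + signed_tens x y x' y2'"
    by (subst (1 2 3) signed_tens_finite[of "?s x y1' \<union> ?s x y2'"])
      (auto simp: additive.add[OF additive_coh_proj], simp add: simps)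
  note F = signed_tens_finite[OF finite_signed_tens_support subset_refl]
  show "signed_tens x (y1 + y2) x' y' = signed_tens x y1 x' y' + signed_tens x y2 x' y'"
    unfolding F by (simp add: simps)
  show "signed_tens x y (x1' + x2') y' = signed_tens x y x1' y' + signed_tens x y x2' y'"
    unfolding F by (simp add: simps)
qed

lemma biadditive_signed_tens: "biadditive (signed_tens x y)"
  by (rule biadditiveI) (rule signed_tens_add)+

lemma biadditive_signed_tens_lift: "biadditive (\<lambda>x y. tensor_lift (signed_tens x y) v)"
proof (rule biadditiveI)
  note [simp] = biadditive_signed_tens additive.diff[OF additive_tensor_lift[OF biadditive_signed_tens]]
  show "tensor_lift (signed_tens (x1 + x2) y) v = tensor_lift (signed_tens x1 y) v + tensor_lift (signed_tens x2 y) v"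
    for x1 x2 y
    by (induction v) (simp_all, simp add: signed_tens_add)
  show "tensor_lift (signed_tens x (y1 + y2)) v = tensor_lift (signed_tens x y1) v + tensor_lift (signed_tens x y2) v"
    for x y1 y2
    by (induction v) (simp_all, simp add: signed_tens_add)
qed

lemma kunneth_mult_tens: "kunneth_mult (x \<otimes>\<^sub>Z y) (x' \<otimes>\<^sub>Z y') = signed_tens x y x' y'"
  using tensor_lift_tens[OF biadditive_signed_tens_lift, of "x' \<otimes>\<^sub>Z y'" x y]
  by (simp add: kunneth_mult_def biadditive_signed_tens)

lemma biadditive_kunneth_mult: "biadditive kunneth_mult"
proof (rule biadditiveI)
  fix u u' v v' :: "(('a, 'b) coh, ('c, 'd) coh) tensor"
  show "kunneth_mult (u + u') v = kunneth_mult u v + kunneth_mult u' v"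
    unfolding kunneth_mult_def by (rule additive.add[OF additive_tensor_lift[OF biadditive_signed_tens_lift]])
  show "kunneth_mult u (v + v') = kunneth_mult u v + kunneth_mult u v'"
  proof (induction u)
    case (tens x y)
    have "kunneth_mult (x \<otimes>\<^sub>Z y) w = tensor_lift (signed_tens x y) w" for w
      unfolding kunneth_mult_def
      by (rule tensor_lift_tens[OF biadditive_signed_tens_lift])
    then show ?case by (simp add: additive.add[OF additive_tensor_lift[OF biadditive_signed_tens]])
  next
    case (diff s t)
    have "kunneth_mult (s - t) w = kunneth_mult s w - kunneth_mult t w" for w
      unfolding kunneth_mult_def
      by (rule additive.diff[OF additive_tensor_lift[OF biadditive_signed_tens_lift]])
    with diff show ?case by simp
  qed
qed

lemma kunneth_mult_homogeneous:
  assumes "x \<in> trop_coh (int p) (int q)" and "y' \<in> trop_coh (int p') (int q')"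
  shows "kunneth_mult (x \<otimes>\<^sub>Z y) (x' \<otimes>\<^sub>Z y') =
    zmul ((-1) ^ ((p + q) * (p' + q'))) ((x * x') \<otimes>\<^sub>Z (y * y'))"
  unfolding kunneth_mult_tens
  by (subst signed_tens_finite[of "{(p, q, p', q')}"])
    (auto simp: coh_proj_trop_coh[OF assms(1)] coh_proj_trop_coh[OF assms(2)] split: if_splits)


section \<open>Rational coefficients\<close>

definition rat_incl :: "'a::ab_group_add \<Rightarrow> ('a, rat) tensor" where
  "rat_incl x = x \<otimes>\<^sub>Z 1"

definition rat_scale :: "rat \<Rightarrow> ('a::ab_group_add, rat) tensor \<Rightarrow> ('a, rat) tensor" where
  "rat_scale r = tensor_map (\<lambda>x. x) ((*) r)"

definition rat_map :: "('a::ab_group_add \<Rightarrow> 'b::ab_group_add) \<Rightarrow> ('a, rat) tensor \<Rightarrow> ('b, rat) tensor" where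
  "rat_map f = tensor_map f (\<lambda>r. r)"

definition rat_bimap :: "('a::ab_group_add \<Rightarrow> 'b::ab_group_add \<Rightarrow> 'c::ab_group_add)
    \<Rightarrow> ('a, rat) tensor \<Rightarrow> ('b, rat) tensor \<Rightarrow> ('c, rat) tensor" where
  "rat_bimap m u v = tensor_lift (\<lambda>x r. tensor_lift (\<lambda>y s. m x y \<otimes>\<^sub>Z (r * s)) v) u"

definition kunneth_exp ::
  "((('a::ab_group_add, 'b::ab_group_add) coh, ('c::ab_group_add, 'd::ab_group_add) coh) tensor, rat) tensor
    \<Rightarrow> ((('a, 'b) coh, ('c, 'd) coh) tensor, rat) tensor" where
  \<comment> \<open>\<open>Sum_any\<close> sums over the support, which is finite for nilpotent \<open>u\<close>.\<close>
  "kunneth_exp u = Sum_any (\<lambda>k. rat_scale (1 / fact k)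
     ((rat_bimap kunneth_mult u ^^ k) (rat_incl (1 \<otimes>\<^sub>Z 1))))"


section \<open>Real tori with integral structure and the Fourier--Mukai transform\<close>

text \<open>
  The lattices \<open>N\<close> and \<open>\<Lambda>\<close> are the types \<open>'n\<close> and \<open>'l\<close>; the inclusion of \<open>\<Lambda>\<close> into \<open>N\<^sub>\<real>\<close> is an
  injective homomorphism \<open>\<iota>\<close>.  Full rank means that its real extension identifies \<open>\<Lambda>\<^sub>\<real>\<close> with \<open>N\<^sub>\<real>\<close>.
\<close>

definition real_torus :: "nat \<Rightarrow> ('l::ab_group_add \<Rightarrow> ('n::ab_group_add, real) tensor) \<Rightarrow> bool" where
  "real_torus g \<iota> \<longleftrightarrow>
     (\<exists>b :: nat \<Rightarrow> 'n. lattice_basis g b) \<and> (\<exists>b :: nat \<Rightarrow> 'l. lattice_basis g b) \<and>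
     additive \<iota> \<and> inj \<iota> \<and>
     bij (tensor_lift (\<lambda>l r. r *\<^sub>R \<iota> l) :: ('l, real) tensor \<Rightarrow> ('n, real) tensor)"

definition same_orientation :: "nat \<Rightarrow> (nat \<Rightarrow> 'v::real_vector) \<Rightarrow> (nat \<Rightarrow> 'v) \<Rightarrow> bool" where
  "same_orientation g u v \<longleftrightarrow>
     (\<exists>A \<in> carrier_mat g g. (\<forall>k<g. u k = (\<Sum>i<g. (A $$ (i, k)) *\<^sub>R v i)) \<and> Determinant.det A > 0)"

definition top_class :: "nat \<Rightarrow> (nat \<Rightarrow> 'l::ab_group_add) \<Rightarrow> (nat \<Rightarrow> 'n::ab_group_add)
    \<Rightarrow> ('l zdual, 'n zdual) coh" where
  "top_class g lam eta =
     wedge (map (dual_basis g lam) [0..<g]) \<otimes>\<^sub>Z wedge (map (dual_basis g eta) [0..<g])"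

definition delta :: "nat \<Rightarrow> (nat \<Rightarrow> 'l::ab_group_add) \<Rightarrow> (nat \<Rightarrow> 'n::ab_group_add)
    \<Rightarrow> ('l zdual, 'n zdual) coh \<Rightarrow> int" where
  "delta g lam eta x = (THE n. coh_proj g g x = zmul n (top_class g lam eta))"

definition pull1 :: "('l::ab_group_add zdual, 'n::ab_group_add zdual) coh
    \<Rightarrow> (('l zdual, 'n zdual) coh, ('n, 'l) coh) tensor" where
  "pull1 x = x \<otimes>\<^sub>Z 1"

definition push2 :: "nat \<Rightarrow> (nat \<Rightarrow> 'l::ab_group_add) \<Rightarrow> (nat \<Rightarrow> 'n::ab_group_add)
    \<Rightarrow> (('l zdual, 'n zdual) coh, ('n, 'l) coh) tensor \<Rightarrow> ('n, 'l) coh" where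
  "push2 g lam eta = tensor_lift (\<lambda>x y. zmul (delta g lam eta x) y)"

definition poincare_chern :: "nat \<Rightarrow> (nat \<Rightarrow> 'l::ab_group_add) \<Rightarrow> (nat \<Rightarrow> 'n::ab_group_add)
    \<Rightarrow> (('l zdual, 'n zdual) coh, ('n, 'l) coh) tensor" where
  "poincare_chern g lam eta =
     - (\<Sum>i<g. (1 \<otimes>\<^sub>Z ext_of (dual_basis g eta i)) \<otimes>\<^sub>Z (ext_of (eta i) \<otimes>\<^sub>Z 1))
     - (\<Sum>i<g. (ext_of (dual_basis g lam i) \<otimes>\<^sub>Z 1) \<otimes>\<^sub>Z (1 \<otimes>\<^sub>Z ext_of (lam i)))"

definition fourier_mukai :: "nat \<Rightarrow> (nat \<Rightarrow> 'l::ab_group_add) \<Rightarrow> (nat \<Rightarrow> 'n::ab_group_add)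
    \<Rightarrow> (('l zdual, 'n zdual) coh, rat) tensor \<Rightarrow> (('n, 'l) coh, rat) tensor" where
  "fourier_mukai g lam eta \<alpha> =
     rat_map (push2 g lam eta)
       (rat_bimap kunneth_mult (kunneth_exp (rat_incl (poincare_chern g lam eta))) (rat_map pull1 \<alpha>))"

end

theory Submission
  imports Defs
begin

text \<open>
  For a lattice with basis \<open>a\<^sub>1, \<dots>, a\<^sub>g\<close> and a second one with basis \<open>b\<^sub>1, \<dots>, b\<^sub>g\<close>, the elements
  \<open>a\<^sub>i \<otimes> b\<^sub>i\<close> of the (unsigned) tensor product of the exterior algebras commute and square to zero, so
  \<open>(\<Sum>\<^sub>i a\<^sub>i \<otimes> b\<^sub>i)\<^sup>s = s! \<cdot> \<theta>\<^sub>s\<close> with \<open>\<theta>\<^sub>s = \<Sum>\<^bsub>|S| = s\<^esub> a\<^sub>S \<otimes> b\<^sub>S\<close>.  Splitting \<open>c\<^sub>1(\<P>)\<close> into its \<open>\<Lambda>\<close>-part and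
  its \<open>N\<close>-part, the divided power \<open>c\<^sub>1(\<P>)\<^sup>k / k!\<close> becomes, up to a sign that depends only on \<open>k\<close>, the sum
  of the products of \<open>\<theta>\<^sub>s\<close> for \<open>\<Lambda>\<close> and \<open>\<theta>\<^bsub>k-s\<^esub>\<close> for \<open>N\<close>; in particular it is integral.  Pushing
  forward against \<open>\<alpha> \<otimes> \<omega>\<close> replaces \<open>a\<^sub>S\<close> by the coefficient of the top class in \<open>a\<^sub>S \<and> \<alpha>\<close>, so on bidegree
  \<open>(p, q)\<close> the transform is \<open>\<alpha> \<otimes> \<omega> \<mapsto> \<plusminus> \<star>\<omega> \<otimes> \<star>\<alpha>\<close> with a constant sign, where
  \<open>\<star>x = \<Sum>\<^sub>S vol (a\<^sub>S \<and> x) b\<^sub>S\<close> is a Hodge star, which permutes the basis words up to sign.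
\<close>

section \<open>Integer multiples, additive maps and generated subgroups\<close>

lemma zmul_int [simp]: "zmul n (m :: int) = n * m"
  by (induction n rule: int_induct[where k = 0])
    (simp_all add: zmul_plus1 zmul_minus1 algebra_simps)

lemma additive_mult_left: "additive (\<lambda>y. x * (y :: 'a::ring))"
  by (simp add: additive_def distrib_left)

lemma additive_mult_right: "additive (\<lambda>y. (y :: 'a::ring) * x)"
  by (simp add: additive_def distrib_right)

lemma zmul_mult_left: "zmul n x * (y :: 'a::ring) = zmul n (x * y)"
  using zmul_additive[OF additive_mult_right] .

lemma zmul_mult_right: "x * zmul n (y :: 'a::ring) = zmul n (x * y)"
  using zmul_additive[OF additive_mult_left] .

lemma additive_zmul_left: "additive f \<Longrightarrow> additive (\<lambda>x. zmul (f x) y)"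
  by (simp add: additive_def zmul_add_left)

lemma additive_comp: "additive f \<Longrightarrow> additive h \<Longrightarrow> additive (\<lambda>x. f (h x))"
  by (simp add: additive_def)

lemma additive_sum: "(\<And>i. i \<in> I \<Longrightarrow> additive (f i)) \<Longrightarrow> additive (\<lambda>x. \<Sum>i\<in>I. f i x)"
  by (simp add: additive_def sum.distrib)

lemma additive_eq_on_group_closure:
  assumes "additive f" "additive h" "\<And>s. s \<in> S \<Longrightarrow> f s = h s" "x \<in> group_closure S"
  shows "f x = h x"
  using assms(4)
proof induction
  case (base s)
  then show ?case using assms(3) additive.zero[OF assms(1)] additive.zero[OF assms(2)] by auto
qed (simp add: additive.diff[OF assms(1)] additive.diff[OF assms(2)])

lemma group_closure_sum: "(\<And>i. i \<in> I \<Longrightarrow> f i \<in> group_closure S) \<Longrightarrow> (\<Sum>i\<in>I. f i) \<in> group_closure S"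
  by (induction I rule: infinite_finite_induct) (auto intro: group_closure_add)

lemma group_closure_zmul: "x \<in> group_closure S \<Longrightarrow> zmul n x \<in> group_closure S"
  by (induction n rule: int_induct[where k = 0])
    (simp_all add: zmul_plus1 zmul_minus1 group_closure_add group_closure.diff)

lemma group_closure_base: "x \<in> S \<Longrightarrow> x \<in> group_closure S"
  by (rule group_closure.base) simp


section \<open>Coordinates\<close>

definition coord :: "nat \<Rightarrow> (nat \<Rightarrow> 'a::ab_group_add) \<Rightarrow> 'a \<Rightarrow> nat \<Rightarrow> int" where
  "coord g a x = (THE c. (\<forall>i\<ge>g. c i = 0) \<and> x = (\<Sum>i<g. zmul (c i) (a i)))"

lemma coord_unique:
  assumes "lattice_basis g a" "\<And>i. i \<ge> g \<Longrightarrow> c i = 0" "x = (\<Sum>i<g. zmul (c i) (a i))"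
  shows "coord g a x = c"
  unfolding coord_def using assms unfolding lattice_basis_def by (intro the1_equality) auto

lemma coord_expand:
  assumes "lattice_basis g a"
  shows "i \<ge> g \<Longrightarrow> coord g a x i = 0" "x = (\<Sum>i<g. zmul (coord g a x i) (a i))"
proof -
  have "\<exists>!c. (\<forall>i\<ge>g. c i = 0) \<and> x = (\<Sum>i<g. zmul (c i) (a i))"
    using assms by (simp add: lattice_basis_def)
  from theI'[OF this] have *: "(\<forall>i\<ge>g. coord g a x i = 0) \<and> x = (\<Sum>i<g. zmul (coord g a x i) (a i))"
    by (simp add: coord_def)
  show "i \<ge> g \<Longrightarrow> coord g a x i = 0" using * by simp
  show "x = (\<Sum>i<g. zmul (coord g a x i) (a i))" by (rule conjunct2[OF *])
qed

lemma coord_add: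
  assumes "lattice_basis g a"
  shows "coord g a (x + y) i = coord g a x i + coord g a y i"
proof -
  have "coord g a (x + y) = (\<lambda>i. coord g a x i + coord g a y i)"
    using coord_expand[OF assms] by (intro coord_unique[OF assms])
      (auto simp: zmul_add_left sum.distrib)
  then show ?thesis by simp
qed

lemma coord_basis:
  assumes "lattice_basis g a" "i < g"
  shows "coord g a (a i) j = of_bool (i = j)"
proof -
  have "coord g a (a i) = (\<lambda>j. of_bool (i = j))"
  proof (rule coord_unique[OF assms(1)])
    have "zmul (of_bool (i = j)) (a j) = (if i = j then a j else 0)" for j by simp
    then show "a i = (\<Sum>j<g. zmul (of_bool (i = j)) (a j))" using assms(2) by simp
  qed (use assms(2) in auto)
  then show ?thesis by simp
qed

section \<open>Integral functionals and the dual basis\<close>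

lemma zeval_sum: "zeval (\<Sum>i\<in>I. f i) x = (\<Sum>i\<in>I. zeval (f i) x)"
  by (induction I rule: infinite_finite_induct) (simp_all add: zero_zdual.rep_eq plus_zdual.rep_eq)

lemma zeval_zmul: "zeval (zmul n f) x = n * zeval f x"
  using zmul_additive[of "\<lambda>f. zeval f x" n f] by (simp add: additive_def plus_zdual.rep_eq)

lemma zeval_coord:
  assumes "lattice_basis g b"
  shows "zeval f x = (\<Sum>i<g. coord g b x i * zeval f (b i))"
proof -
  have A: "additive (zeval f)" using zeval[of f] by simp
  have "zeval f x = zeval f (\<Sum>i<g. zmul (coord g b x i) (b i))"
    using coord_expand(2)[OF assms] by simp
  then show ?thesis by (simp add: additive.sum[OF A] zmul_additive[OF A])
qed

lemma zdual_eqI: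
  assumes "lattice_basis g b" "\<And>k. k < g \<Longrightarrow> zeval f (b k) = zeval h (b k)"
  shows "f = h"
proof -
  have "zeval f = zeval h"
    by (rule ext) (subst (1 2) zeval_coord[OF assms(1)], simp add: assms(2))
  then show ?thesis by (simp add: zeval_inject)
qed

lemma zeval_dual_basis:
  assumes "lattice_basis g b" "k < g"
  shows "zeval (dual_basis g b i) (b k) = of_bool (i = k)"
proof -
  have "\<exists>!f. \<forall>k<g. zeval f (b k) = of_bool (i = k)"
  proof (rule ex_ex1I)
    \<comment> \<open>The functional taking the \<open>i\<close>-th coordinate is the witness. For
      \<open>i \<ge> g\<close> it is zero, and so are all prescribed values.\<close>
    have "zeval (Abs_zdual (\<lambda>x. coord g b x i)) (b k) = of_bool (i = k)" if "k < g" for k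
      using coord_basis[OF assms(1) that]
      by (subst Abs_zdual_inverse) (auto simp: additive_def coord_add[OF assms(1)])
    then show "\<exists>f. \<forall>k<g. zeval f (b k) = of_bool (i = k)" by blast
  next
    fix f h :: "'a zdual"
    assume "\<forall>k<g. zeval f (b k) = of_bool (i = k)" "\<forall>k<g. zeval h (b k) = of_bool (i = k)"
    then show "f = h" by (intro zdual_eqI[OF assms(1)]) simp
  qed
  from theI'[OF this] show ?thesis using assms(2) by (simp add: dual_basis_def)
qed

text \<open>Evaluating a combination of dual vectors at \<open>b k\<close> returns its
  \<open>k\<close>-th coefficient, which gives uniqueness. For existence the values of
  \<open>f\<close> on the basis serve as coefficients, because a functional is determined by
  them.\<close>

lemma lattice_basis_dual_basis:
  assumes "lattice_basis g b"
  shows "lattice_basis g (dual_basis g b)"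
proof -
  have eval: "zeval (\<Sum>i<g. zmul (c i) (dual_basis g b i)) (b k) = c k" if "k < g" for c k
  proof -
    have "c i * of_bool (i = k) = (if i = k then c i else 0)" for i by simp
    then show ?thesis
      using that by (simp add: zeval_sum zeval_zmul zeval_dual_basis[OF assms])
  qed
  show ?thesis unfolding lattice_basis_def
  proof (rule allI, rule ex1I)
    fix f :: "'a zdual"
    let ?c = "\<lambda>i. if i < g then zeval f (b i) else 0"
    have "f = (\<Sum>i<g. zmul (?c i) (dual_basis g b i))"
      by (rule zdual_eqI[OF assms]) (use eval[of _ ?c] in simp)
    then show "(\<forall>i\<ge>g. ?c i = 0) \<and> f = (\<Sum>i<g. zmul (?c i) (dual_basis g b i))" by simp
    fix d :: "nat \<Rightarrow> int"
    assume d: "(\<forall>i\<ge>g. d i = 0) \<and> f = (\<Sum>i<g. zmul (d i) (dual_basis g b i))"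
    show "d = ?c" by (rule ext) (use d eval[of _ d] in auto)
  qed
qed


section \<open>Basis words in the exterior algebra\<close>

lemma ext_of_add: "ext_of (a + b) = ext_of a + ext_of b"
  by transfer (use ext_rels_add[of "[]"] in
      \<open>auto simp: ext_eq_def diff_diff_eq[symmetric] intro!: group_closure_base\<close>)

lemma additive_ext_of: "additive ext_of"
  by (simp add: additive_def ext_of_add)

lemma ext_of_square [simp]: "ext_of a * ext_of a = 0"
  by transfer (use ext_rels_square[of "[]"] in \<open>auto simp: ext_eq_def intro!: group_closure_base\<close>)

text \<open>Polarisation: in the square of \<open>a + b\<close> only the two mixed terms
  survive.\<close>

lemma ext_of_anticommute: "ext_of a * ext_of b = - (ext_of b * ext_of a)"
proof -
  have "ext_of a * ext_of b + ext_of b * ext_of a = 0"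
    using ext_of_square[of "a + b"] by (simp add: ext_of_add distrib_left distrib_right del: ext_of_square)
      (simp add: add.commute)
  then show ?thesis by (simp add: eq_neg_iff_add_eq_0)
qed

lemma wedge_Nil [simp]: "wedge [] = 1"
  by (simp add: wedge_def)

lemma wedge_Cons: "wedge (x # xs) = ext_of x * wedge xs"
  by (simp add: wedge_def)

lemma wedge_append: "wedge (xs @ ys) = wedge xs * wedge ys"
  by (simp add: wedge_def)

lemma wedge_single [simp]: "wedge [x] = ext_of x"
  by (simp add: wedge_def)

lemma ext_of_wedge_commute: "ext_of x * wedge ys = zmul ((-1) ^ length ys) (wedge ys * ext_of x)"
proof (induction ys)
  case (Cons y ys)
  have "ext_of x * wedge (y # ys) = - (ext_of y * (ext_of x * wedge ys))"
    using ext_of_anticommute[of x y] by (simp add: wedge_Cons mult.assoc[symmetric])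
  then show ?case by (simp add: Cons zmul_mult_right mult.assoc wedge_Cons)
qed simp

text \<open>Letters come in increasing order and indices from \<open>m\<close> on are ignored.
  Raising the bound by one thus appends at most one letter on the right, which is what the
  inductions on \<open>m\<close> use.\<close>

definition basis_wedge :: "(nat \<Rightarrow> 'a::ab_group_add) \<Rightarrow> nat \<Rightarrow> nat set \<Rightarrow> 'a ext" where
  "basis_wedge a m S = wedge (map a (filter (\<lambda>i. i \<in> S) [0..<m]))"

text \<open>The sign comes from moving each \<open>a\<^sub>i\<close>, \<open>i \<in> S\<close>, past the \<open>a\<^sub>j\<close> with \<open>j \<in> U\<close> and \<open>j < i\<close>.\<close>

definition shuffle_sign :: "nat \<Rightarrow> nat set \<Rightarrow> nat set \<Rightarrow> int" where
  "shuffle_sign m S U = (\<Prod>i<m. if i \<in> S then if i \<in> U then 0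
     else (-1) ^ length (filter (\<lambda>j. j \<in> U) [0..<i]) else 1)"

lemma basis_wedge_0 [simp]: "basis_wedge a 0 S = 1"
  by (simp add: basis_wedge_def)

lemma basis_wedge_Suc:
  "basis_wedge a (Suc m) S = basis_wedge a m S * (if m \<in> S then ext_of (a m) else 1)"
  by (simp add: basis_wedge_def wedge_append)

text \<open>Induction on \<open>m\<close>: the last letter of the left word crosses the right word
  below \<open>m\<close>, at the cost of one sign per letter, and then meets the possible last
  letter of the right word, where a repetition gives zero.\<close>

lemma basis_wedge_mult:
  "basis_wedge a m S * basis_wedge a m U = zmul (shuffle_sign m S U) (basis_wedge a m (S \<union> U))"
proof (induction m)
  case 0
  show ?case by (simp add: shuffle_sign_def)
next
  case (Suc m)
  define k where "k = length (filter (\<lambda>j. j \<in> U) [0..<m])"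
  have comm: "ext_of (a m) * basis_wedge a m U = zmul ((-1) ^ k) (basis_wedge a m U * ext_of (a m))"
    by (simp add: basis_wedge_def ext_of_wedge_commute k_def)
  have sgn: "shuffle_sign (Suc m) S U =
      shuffle_sign m S U * (if m \<in> S then if m \<in> U then 0 else (-1) ^ k else 1)"
    by (simp add: shuffle_sign_def k_def)
  show ?case
  proof (cases "m \<in> S")
    case True
    have "basis_wedge a (Suc m) S * basis_wedge a (Suc m) U = basis_wedge a m S *
        (ext_of (a m) * basis_wedge a m U) * (if m \<in> U then ext_of (a m) else 1)"
      using True by (simp add: basis_wedge_Suc mult.assoc)
    also have "\<dots> = zmul ((-1) ^ k) (basis_wedge a m S * basis_wedge a m U *
        (ext_of (a m) * (if m \<in> U then ext_of (a m) else 1)))"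
      by (simp add: comm zmul_mult_left zmul_mult_right mult.assoc)
    also have "\<dots> = zmul (shuffle_sign (Suc m) S U) (basis_wedge a (Suc m) (S \<union> U))"
      using True
      by (simp add: Suc zmul_mult_left sgn basis_wedge_Suc zmul_zmul mult.commute)
    finally show ?thesis .
  next
    case False
    then show ?thesis
      by (simp add: basis_wedge_Suc mult.assoc[symmetric] Suc sgn zmul_mult_left)
  qed
qed

text \<open>Without overlap every factor is 1 or -1. That the sign is a unit of the integers makes
  the star below integrally invertible.\<close>

lemma shuffle_sign_disjoint:
  "S \<inter> U \<inter> {..<m} = {} \<Longrightarrow> shuffle_sign m S U * shuffle_sign m S U = 1"
  unfolding shuffle_sign_def prod.distrib[symmetric]
  by (rule prod.neutral) (auto simp: power_mult_distrib[symmetric])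

lemma shuffle_sign_overlap:
  "S \<inter> U \<inter> {..<m} \<noteq> {} \<Longrightarrow> shuffle_sign m S U = 0"
  unfolding shuffle_sign_def by (auto intro!: prod_zero)

text \<open>A word is built by appending letters on the right. Each letter expands in the basis, and
  a basis word times a basis vector is an integer multiple of a basis word. This gives generation
  only; detecting coefficients is left to the volume form.\<close>

lemma basis_wedge_span:
  assumes "lattice_basis g a"
  shows "x \<in> group_closure (basis_wedge a g ` Pow {..<g})" (is "_ \<in> ?C")
proof (induction x)
  case (wedge xs)
  have step: "y * ext_of (a i) \<in> ?C" if "y \<in> ?C" "i < g" for y i
  proof (rule additive_group_closure[OF additive_mult_right _ that(1)])
    fix s assume "s \<in> basis_wedge a g ` Pow {..<g}"
    then obtain S where S: "S \<subseteq> {..<g}" "s = basis_wedge a g S" by auto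
    \<comment> \<open>A single letter is the basis word of \<open>{i}\<close>, so the product
      formula for basis words applies to it.\<close>
    have "filter (\<lambda>j. j = i) [0..<g] = [i]"
      using that(2) by (induction g) (auto simp: less_Suc_eq)
    then have "ext_of (a i) = basis_wedge a g {i}" by (simp add: basis_wedge_def)
    then have "s * ext_of (a i) = zmul (shuffle_sign g S {i}) (basis_wedge a g (S \<union> {i}))"
      by (simp add: S basis_wedge_mult)
    moreover have "basis_wedge a g (S \<union> {i}) \<in> basis_wedge a g ` Pow {..<g}"
      using S(1) that(2) by (intro imageI) auto
    ultimately show "s * ext_of (a i) \<in> ?C"
      by (metis group_closure_base group_closure_zmul)
  qed
  show ?case
  proof (induction xs rule: rev_induct)
    case Nil
    have "(1 :: 'a ext) = basis_wedge a g {}" by (simp add: basis_wedge_def)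
    then show ?case by (auto intro!: group_closure_base)
  next
    case (snoc x xs)
    have "ext_of x = (\<Sum>i<g. zmul (coord g a x i) (ext_of (a i)))"
      using arg_cong[OF coord_expand(2)[OF assms, of x], of ext_of]
      by (simp add: additive.sum[OF additive_ext_of] zmul_additive[OF additive_ext_of])
    then have "wedge (xs @ [x]) = (\<Sum>i<g. zmul (coord g a x i) (wedge xs * ext_of (a i)))"
      by (simp add: wedge_append sum_distrib_left zmul_mult_right)
    then show ?case using step[OF snoc] by (auto intro!: group_closure_sum group_closure_zmul)
  qed
next
  case (diff x y)
  then show ?case by (rule group_closure.diff)
qed

lemma additive_eq_on_basis_wedge:
  assumes "lattice_basis g a" "additive f" "additive h"
    and "\<And>S. S \<subseteq> {..<g} \<Longrightarrow> f (basis_wedge a g S) = h (basis_wedge a g S)"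
  shows "f x = h x"
  by (rule additive_eq_on_group_closure[OF assms(2,3) _ basis_wedge_span[OF assms(1)]])
    (use assms(4) in auto)

lemma length_filter_subset:
  assumes "S \<subseteq> {..<m}"
  shows "length (filter (\<lambda>i. i \<in> S) [0..<m]) = card S"
proof -
  have "set (filter (\<lambda>i. i \<in> S) [0..<m]) = S" using assms by auto
  then show ?thesis using distinct_card[of "filter (\<lambda>i. i \<in> S) [0..<m]"] by simp
qed


section \<open>The volume form\<close>

text \<open>Universal property of the exterior algebra as an abelian group: the hypotheses say that
  the additive extension of \<open>f\<close> to formal sums of words kills \<open>ext_rels\<close>,
  so its value does not depend on the representative.\<close>

lemma ext_lift_exists:
  fixes f :: "'a::ab_group_add list \<Rightarrow> 'b::ab_group_add"
  assumes "\<And>xs a b ys. f (xs @ [a + b] @ ys) = f (xs @ [a] @ ys) + f (xs @ [b] @ ys)"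
    and "\<And>xs a ys. f (xs @ [a, a] @ ys) = 0"
  shows "\<exists>h. additive h \<and> (\<forall>xs. h (wedge xs) = f xs)"
proof -
  define h where "h x = free_lift f (rep_ext x)" for x
  have abs: "h (abs_ext u) = free_lift f u" for u
  proof -
    have "ext_eq (rep_ext (abs_ext u)) u"
      by (rule Quotient3_rep_abs[OF Quotient3_ext]) (simp add: ext_eq_def)
    then have "free_lift f (rep_ext (abs_ext u) - u) = 0"
      unfolding ext_eq_def
    proof (rule additive_zero_on_group_closure[OF additive_free_lift, rotated])
      fix s :: "'a list \<Rightarrow>\<^sub>0 int" assume "s \<in> ext_rels"
      then show "free_lift f s = 0"
        using assms(1) assms(2)
        by (cases rule: ext_rels_cases) (simp_all add: additive.diff[OF additive_free_lift])
    qed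
    then show ?thesis by (simp add: h_def additive.diff[OF additive_free_lift])
  qed
  have "additive h"
  proof
    fix x y :: "'a ext"
    obtain u v where "x = abs_ext u" "y = abs_ext v"
      by (metis Quotient3_abs_rep Quotient3_ext)
    then show "h (x + y) = h x + h y"
      by (simp add: plus_ext.abs_eq abs additive.add[OF additive_free_lift])
  qed
  then show ?thesis by (intro exI[of _ h]) (simp add: wedge_abs abs)
qed

text \<open>The value 0 on words of other lengths makes this a function on all words, as
  \<open>ext_lift_exists\<close> requires.\<close>

definition coord_det :: "nat \<Rightarrow> (nat \<Rightarrow> 'a::ab_group_add) \<Rightarrow> 'a list \<Rightarrow> int" where
  "coord_det g a xs =
     (if length xs = g then Determinant.det (mat g g (\<lambda>(i, j). coord g a (xs ! i) j)) else 0)"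

text \<open>Every summand of the Leibniz formula contains exactly one entry of row
  \<open>length xs\<close>, and that entry is additive in the inserted vector.\<close>

lemma coord_det_add:
  assumes "lattice_basis g a"
  shows "coord_det g a (xs @ [x + y] @ ys) = coord_det g a (xs @ [x] @ ys) + coord_det g a (xs @ [y] @ ys)"
proof (cases "length xs + Suc (length ys) = g")
  case True
  define k where "k = length xs"
  let ?c = "\<lambda>z i j. coord g a ((xs @ [z] @ ys) ! i) j"
  have k: "k < g" using True by (simp add: k_def)
  have ck: "?c z k = coord g a z" for z by (simp add: k_def nth_append)
  \<comment> \<open>The other rows do not see the inserted vector. Writing them with
    \<open>x\<close> gives all three determinants the same remaining product.\<close>
  have ci: "?c z i = ?c x i" if "i \<noteq> k" for z i
    using that by (auto simp: k_def nth_append nth_Cons')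
  have split: "(\<Prod>i=0..<g. ?c z i (p i)) = coord g a z (p k) * (\<Prod>i\<in>{0..<g} - {k}. ?c x i (p i))" for z p
  proof -
    have "(\<Prod>i=0..<g. ?c z i (p i)) = ?c z k (p k) * (\<Prod>i\<in>{0..<g} - {k}. ?c z i (p i))"
      using k by (intro prod.remove) auto
    also have "(\<Prod>i\<in>{0..<g} - {k}. ?c z i (p i)) = (\<Prod>i\<in>{0..<g} - {k}. ?c x i (p i))"
      by (rule prod.cong[OF refl], rule fun_cong[OF ci]) simp
    finally show ?thesis using ck by simp
  qed
  have "coord_det g a (xs @ [z] @ ys) = (\<Sum>p | p permutes {0..<g}. signof p * (\<Prod>i=0..<g. ?c z i (p i)))" for z
  proof -
    have "(\<Prod>i=0..<g. mat g g (\<lambda>(i, j). ?c z i j) $$ (i, p i)) = (\<Prod>i=0..<g. ?c z i (p i))"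
      if "p permutes {0..<g}" for p
      using permutes_in_image[OF that] by (intro prod.cong) auto
    then show ?thesis
      using True by (simp add: coord_det_def det_def'[of _ g])
  qed
  then show ?thesis
    by (simp only: split coord_add[OF assms] distrib_left distrib_right sum.distrib)
qed (simp add: coord_det_def)

lemma coord_det_square: "coord_det g a (xs @ [x, x] @ ys) = 0"
proof (cases "length xs + Suc (Suc (length ys)) = g")
  case True
  let ?M = "mat g g (\<lambda>(i, j). coord g a ((xs @ [x, x] @ ys) ! i) j)"
  have "Determinant.det ?M = 0"
  proof (rule det_identical_rows[of _ g "length xs" "Suc (length xs)"])
    show "row ?M (length xs) = row ?M (Suc (length xs))"
      using True by (intro eq_vecI) (auto simp: nth_append)
  qed (use True in auto)
  then show ?thesis by (simp add: coord_det_def)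
qed (simp add: coord_det_def)

text \<open>The determinant in coordinates as a functional on the whole exterior algebra. Since it
  takes the value 1 on the full basis word, that word is not torsion.\<close>

definition volume :: "nat \<Rightarrow> (nat \<Rightarrow> 'a::ab_group_add) \<Rightarrow> 'a ext \<Rightarrow> int" where
  "volume g a = (SOME v. additive v \<and> (\<forall>xs. v (wedge xs) = coord_det g a xs))"

lemma volume:
  assumes "lattice_basis g a"
  shows "additive (volume g a)" "volume g a (wedge xs) = coord_det g a xs"
  using someI_ex[OF ext_lift_exists[of "coord_det g a", OF coord_det_add[OF assms] coord_det_square]]
  by (auto simp: volume_def)

lemma volume_degree:
  assumes "lattice_basis g a" "x \<in> ext_power k" "k \<noteq> int g"
  shows "volume g a x = 0"
  using volume(1)[OF assms(1)] _ assms(2)[unfolded ext_power_def]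
  by (rule additive_zero_on_group_closure) (use assms(3) in \<open>auto simp: volume(2)[OF assms(1)] coord_det_def\<close>)

lemma ext_power_mult:
  assumes "x \<in> ext_power k" "y \<in> ext_power l"
  shows "x * y \<in> ext_power (k + l)"
  unfolding ext_power_def
proof (rule additive_group_closure[OF additive_mult_left _ assms(2)[unfolded ext_power_def]])
  fix s :: "'a ext" assume "s \<in> {wedge xs |xs. int (length xs) = l}"
  then obtain ys where ys: "s = wedge ys" "int (length ys) = l" by auto
  show "x * s \<in> group_closure {wedge xs |xs. int (length xs) = k + l}"
  proof (rule additive_group_closure[OF additive_mult_right _ assms(1)[unfolded ext_power_def]])
    fix r :: "'a ext" assume "r \<in> {wedge xs |xs. int (length xs) = k}"
    then obtain xs where "r = wedge xs" "int (length xs) = k" by auto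
    then have "r * s = wedge (xs @ ys)" "int (length (xs @ ys)) = k + l"
      using ys by (simp_all add: wedge_append)
    then show "r * s \<in> group_closure {wedge xs |xs. int (length xs) = k + l}"
      by (intro group_closure_base) blast
  qed
qed

lemma basis_wedge_power: "S \<subseteq> {..<m} \<Longrightarrow> basis_wedge a m S \<in> ext_power (int (card S))"
  unfolding ext_power_def basis_wedge_def
  by (rule group_closure_base) (force simp: length_filter_subset)

lemma volume_basis_wedge:
  assumes "lattice_basis g a" "S \<subseteq> {..<g}"
  shows "volume g a (basis_wedge a g S) = of_bool (S = {..<g})"
proof (cases "S = {..<g}")
  case True
  have "filter (\<lambda>i. i \<in> S) [0..<g] = [0..<g]" using True by (simp add: filter_id_conv)
  moreover have "mat g g (\<lambda>(i, j). coord g a (map a [0..<g] ! i) j) = 1\<^sub>m g"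
    by (rule eq_matI) (auto simp: coord_basis[OF assms(1)])
  ultimately show ?thesis using True
    by (simp add: basis_wedge_def volume(2)[OF assms(1)] coord_det_def)
next
  case False
  then have "card S < g" using assms(2) by (metis card_lessThan finite_lessThan psubsetI psubset_card_mono)
  then show ?thesis using False volume_degree[OF assms(1) basis_wedge_power[OF assms(2)]] by simp
qed

text \<open>On basis words the pairing by product and volume is a signed permutation matrix:
  overlapping words multiply to zero, and disjoint ones reach the full word only if they are
  complementary.\<close>

lemma volume_basis_wedge_mult:
  assumes "lattice_basis g a" "S \<subseteq> {..<g}" "U \<subseteq> {..<g}"
  shows "volume g a (basis_wedge a g S * basis_wedge a g U) =
    (if U = {..<g} - S then shuffle_sign g S U else 0)"
proof -
  have eq: "volume g a (basis_wedge a g S * basis_wedge a g U) = shuffle_sign g S U * of_bool (S \<union> U = {..<g})"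
    using assms(2,3) by (simp add: basis_wedge_mult zmul_additive[OF volume(1)[OF assms(1)]]
        volume_basis_wedge[OF assms(1)])
  show ?thesis
  proof (cases "S \<inter> U \<inter> {..<g} = {}")
    case True
    then have "S \<union> U = {..<g} \<longleftrightarrow> U = {..<g} - S" using assms(2,3) by blast
    then show ?thesis by (simp add: eq)
  next
    case False
    then have "U \<noteq> {..<g} - S" by blast
    with False show ?thesis by (simp add: eq shuffle_sign_overlap)
  qed
qed

text \<open>By additivity basis words suffice, and the only one of degree \<open>g\<close> is the
  full one.\<close>

lemma ext_proj_top:
  assumes "lattice_basis g a"
  shows "ext_proj g x = zmul (volume g a x) (wedge (map a [0..<g]))"
proof (rule additive_eq_on_basis_wedge[OF assms additive_ext_proj])
  show "additive (\<lambda>x. zmul (volume g a x) (wedge (map a [0..<g])))"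
    by (intro additive_zmul_left volume assms)
  fix S assume S: "S \<subseteq> {..<g}"
  have "card S = g \<longleftrightarrow> S = {..<g}"
    using S card_subset_eq[of "{..<g}" S] by auto
  moreover have "basis_wedge a g {..<g} = wedge (map a [0..<g])"
    by (simp add: basis_wedge_def cong: filter_cong)
  ultimately show "ext_proj g (basis_wedge a g S) =
      zmul (volume g a (basis_wedge a g S)) (wedge (map a [0..<g]))"
    using S by (auto simp: ext_proj_ext_power[OF basis_wedge_power[OF S]] volume_basis_wedge[OF assms])
qed


section \<open>The Hodge star of a lattice with a basis\<close>

definition hodge :: "nat \<Rightarrow> (nat \<Rightarrow> 'a::ab_group_add) \<Rightarrow> (nat \<Rightarrow> 'b::ab_group_add) \<Rightarrow> 'a ext \<Rightarrow> 'b ext" where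
  "hodge g a b x = (\<Sum>S\<in>Pow {..<g}. zmul (volume g a (basis_wedge a g S * x)) (basis_wedge b g S))"

text \<open>The basis word stands on the right here and on the left in \<open>hodge\<close>. With
  this choice a basis word and its image carry the same shuffle sign in both directions, so the
  composites need no sign depending on the degree.\<close>

definition hodge_inv :: "nat \<Rightarrow> (nat \<Rightarrow> 'a::ab_group_add) \<Rightarrow> (nat \<Rightarrow> 'b::ab_group_add) \<Rightarrow> 'b ext \<Rightarrow> 'a ext" where
  "hodge_inv g a b y = (\<Sum>S\<in>Pow {..<g}. zmul (volume g b (y * basis_wedge b g S)) (basis_wedge a g S))"

lemma additive_hodge: "lattice_basis g a \<Longrightarrow> additive (hodge g a b)"
  unfolding hodge_def
  by (intro additive_sum additive_zmul_left additive_comp[OF volume(1) additive_mult_left])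

lemma additive_hodge_inv: "lattice_basis g b \<Longrightarrow> additive (hodge_inv g a b)"
  unfolding hodge_inv_def
  by (intro additive_sum additive_zmul_left additive_comp[OF volume(1) additive_mult_right])

lemma hodge_basis_wedge:
  assumes "lattice_basis g a" "U \<subseteq> {..<g}"
  shows "hodge g a b (basis_wedge a g U) =
    zmul (shuffle_sign g ({..<g} - U) U) (basis_wedge b g ({..<g} - U))"
proof -
  have "hodge g a b (basis_wedge a g U) =
      (\<Sum>S\<in>Pow {..<g}. if S = {..<g} - U then zmul (shuffle_sign g S U) (basis_wedge b g S) else 0)"
    unfolding hodge_def using assms(2)
    by (intro sum.cong) (auto simp: volume_basis_wedge_mult[OF assms(1)] double_diff)
  then show ?thesis by simp
qed

lemma hodge_inv_basis_wedge:
  assumes "lattice_basis g b" "U \<subseteq> {..<g}"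
  shows "hodge_inv g a b (basis_wedge b g U) =
    zmul (shuffle_sign g U ({..<g} - U)) (basis_wedge a g ({..<g} - U))"
proof -
  have "hodge_inv g a b (basis_wedge b g U) =
      (\<Sum>S\<in>Pow {..<g}. if S = {..<g} - U then zmul (shuffle_sign g U S) (basis_wedge a g S) else 0)"
    unfolding hodge_inv_def using assms(2)
    by (intro sum.cong) (auto simp: volume_basis_wedge_mult[OF assms(1)])
  then show ?thesis by simp
qed

text \<open>On a basis word the index set is complemented twice and the same shuffle sign occurs
  twice, with square 1.\<close>

lemma hodge_inv_hodge:
  assumes "lattice_basis g a" "lattice_basis g b"
  shows "hodge_inv g a b (hodge g a b x) = x"
proof (rule additive_eq_on_basis_wedge[OF assms(1) _ additive_id])
  show "additive (\<lambda>x. hodge_inv g a b (hodge g a b x))"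
    by (intro additive_comp[OF additive_hodge_inv additive_hodge] assms)
  fix S assume S: "S \<subseteq> {..<g}"
  then have "{..<g} - ({..<g} - S) = S" by blast
  then show "hodge_inv g a b (hodge g a b (basis_wedge a g S)) = basis_wedge a g S"
    using S by (simp add: hodge_basis_wedge[OF assms(1)] zmul_additive[OF additive_hodge_inv[OF assms(2)]]
        hodge_inv_basis_wedge[OF assms(2)] zmul_zmul)
      (subst shuffle_sign_disjoint, auto)
qed

lemma hodge_hodge_inv:
  assumes "lattice_basis g a" "lattice_basis g b"
  shows "hodge g a b (hodge_inv g a b y) = y"
proof (rule additive_eq_on_basis_wedge[OF assms(2) _ additive_id])
  show "additive (\<lambda>y. hodge g a b (hodge_inv g a b y))"
    by (intro additive_comp[OF additive_hodge additive_hodge_inv] assms)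
  fix S assume S: "S \<subseteq> {..<g}"
  then have "{..<g} - ({..<g} - S) = S" by blast
  then show "hodge g a b (hodge_inv g a b (basis_wedge b g S)) = basis_wedge b g S"
    using S by (simp add: hodge_inv_basis_wedge[OF assms(2)] zmul_additive[OF additive_hodge[OF assms(1)]]
        hodge_basis_wedge[OF assms(1)] zmul_zmul)
      (subst shuffle_sign_disjoint, auto)
qed

text \<open>A summand survives only if the size of \<open>S\<close> and \<open>k\<close> add up to
  \<open>g\<close>, since the volume vanishes in all other degrees.\<close>

lemma hodge_ext_power:
  assumes "lattice_basis g a" "x \<in> ext_power k"
  shows "hodge g a b x \<in> ext_power (int g - k)"
  unfolding hodge_def ext_power_def
proof (rule group_closure_sum)
  fix S assume "S \<in> Pow {..<g}"
  then have S: "S \<subseteq> {..<g}" by simp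
  show "zmul (volume g a (basis_wedge a g S * x)) (basis_wedge b g S)
      \<in> group_closure {wedge xs |xs. int (length xs) = int g - k}"
  proof (cases "int (card S) = int g - k")
    case True
    then show ?thesis using basis_wedge_power[OF S, of b]
      by (intro group_closure_zmul) (simp add: ext_power_def)
  next
    case False
    then have "volume g a (basis_wedge a g S * x) = 0"
      by (intro volume_degree[OF assms(1) ext_power_mult[OF basis_wedge_power[OF S] assms(2)]]) simp
    then show ?thesis by simp
  qed
qed

lemma hodge_inv_ext_power:
  assumes "lattice_basis g b" "y \<in> ext_power k"
  shows "hodge_inv g a b y \<in> ext_power (int g - k)"
  unfolding hodge_inv_def ext_power_def
proof (rule group_closure_sum)
  fix S assume "S \<in> Pow {..<g}"
  then have S: "S \<subseteq> {..<g}" by simp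
  show "zmul (volume g b (y * basis_wedge b g S)) (basis_wedge a g S)
      \<in> group_closure {wedge xs |xs. int (length xs) = int g - k}"
  proof (cases "int (card S) = int g - k")
    case True
    then show ?thesis using basis_wedge_power[OF S, of a]
      by (intro group_closure_zmul) (simp add: ext_power_def)
  next
    case False
    then have "volume g b (y * basis_wedge b g S) = 0"
      by (intro volume_degree[OF assms(1) ext_power_mult[OF assms(2) basis_wedge_power[OF S]]]) simp
    then show ?thesis by simp
  qed
qed


section \<open>Divided powers\<close>

definition subsets_of_size :: "nat \<Rightarrow> nat \<Rightarrow> nat set set" where
  "subsets_of_size m s = {S. S \<subseteq> {..<m} \<and> card S = s}"

lemma finite_subsets_of_size [simp]: "finite (subsets_of_size m s)"
  unfolding subsets_of_size_def by (rule finite_subset[of _ "Pow {..<m}"]) auto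

lemma subsets_of_size_0 [simp]: "subsets_of_size m 0 = {{}}"
  unfolding subsets_of_size_def using finite_subset[OF _ finite_lessThan] by (auto simp: card_eq_0_iff)

lemma subsets_of_size_empty:
  assumes "m < s"
  shows "subsets_of_size m s = {}"
proof -
  have "card S \<noteq> s" if "S \<subseteq> {..<m}" for S
    using card_mono[OF finite_lessThan that] assms by simp
  then show ?thesis by (simp add: subsets_of_size_def)
qed

text \<open>Pascal's recursion, by whether the largest index \<open>m\<close> is chosen.\<close>

lemma subsets_of_size_Suc:
  "subsets_of_size (Suc m) (Suc s) = subsets_of_size m (Suc s) \<union> insert m ` subsets_of_size m s"
proof (intro subset_antisym subsetI)
  fix S assume "S \<in> subsets_of_size (Suc m) (Suc s)"
  then have S: "S \<subseteq> {..<Suc m}" "card S = Suc s" "finite S"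
    by (auto simp: subsets_of_size_def intro: finite_subset)
  show "S \<in> subsets_of_size m (Suc s) \<union> insert m ` subsets_of_size m s"
  proof (cases "m \<in> S")
    case True
    then have "S = insert m (S - {m})" "S - {m} \<in> subsets_of_size m s"
      using S by (auto simp: subsets_of_size_def less_Suc_eq)
    then show ?thesis by blast
  next
    case False
    then show ?thesis using S by (auto simp: subsets_of_size_def less_Suc_eq)
  qed
next
  fix S assume "S \<in> subsets_of_size m (Suc s) \<union> insert m ` subsets_of_size m s"
  then show "S \<in> subsets_of_size (Suc m) (Suc s)"
  proof
    assume "S \<in> insert m ` subsets_of_size m s"
    then obtain U where U: "S = insert m U" "U \<subseteq> {..<m}" "card U = s"
      by (auto simp: subsets_of_size_def)
    then have "m \<notin> U" "finite U" by (auto intro: finite_subset)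
    then show ?thesis using U by (auto simp: subsets_of_size_def)
  qed (auto simp: subsets_of_size_def)
qed

text \<open>The elementary symmetric polynomial of degree \<open>s\<close> in the first
  \<open>m\<close> values of \<open>f\<close>, with ordered factors because the ring need not be
  commutative. The sort asks for a unit but not for 0 different from 1, since a tensor product of
  rings may vanish.\<close>

definition divided_power :: "(nat \<Rightarrow> 'r::{ring,monoid_mult}) \<Rightarrow> nat \<Rightarrow> nat \<Rightarrow> 'r" where
  "divided_power f m s =
     (\<Sum>S\<in>subsets_of_size m s. prod_list (map f (filter (\<lambda>i. i \<in> S) [0..<m])))"

lemma divided_power_0 [simp]: "divided_power f m 0 = 1"
  by (simp add: divided_power_def)

lemma divided_power_eq_0: "m < s \<Longrightarrow> divided_power f m s = 0"
  by (simp add: divided_power_def subsets_of_size_empty)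

lemma divided_power_Suc:
  "divided_power f (Suc m) (Suc s) = divided_power f m (Suc s) + divided_power f m s * f m"
proof -
  let ?P = "\<lambda>m S. prod_list (map f (filter (\<lambda>i. i \<in> S) [0..<m]))"
  have disj: "subsets_of_size m (Suc s) \<inter> insert m ` subsets_of_size m s = {}"
    by (auto simp: subsets_of_size_def)
  have inj: "inj_on (insert m) (subsets_of_size m s)"
    by (rule inj_onI) (auto simp: subsets_of_size_def dest: insert_ident[THEN iffD1, rotated 2])
  have old: "?P (Suc m) S = ?P m S" if "S \<in> subsets_of_size m (Suc s)" for S
    using that by (auto simp: subsets_of_size_def)
  \<comment> \<open>The index \<open>m\<close> comes last in the list, so its factor appears on the
    right.\<close>
  have new: "?P (Suc m) (insert m S) = ?P m S * f m" for S
  proof -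
    have "filter (\<lambda>i. i = m \<or> i \<in> S) [0..<m] = filter (\<lambda>i. i \<in> S) [0..<m]"
      by (rule filter_cong) auto
    then show ?thesis by simp
  qed
  have "divided_power f (Suc m) (Suc s) =
      sum (?P (Suc m)) (subsets_of_size m (Suc s)) + sum (?P (Suc m)) (insert m ` subsets_of_size m s)"
    unfolding divided_power_def subsets_of_size_Suc
    by (rule sum.union_disjoint[OF _ _ disj]) simp_all
  also have "sum (?P (Suc m)) (subsets_of_size m (Suc s)) = divided_power f m (Suc s)"
    unfolding divided_power_def by (rule sum.cong[OF refl old])
  also have "sum (?P (Suc m)) (insert m ` subsets_of_size m s) = divided_power f m s * f m"
    unfolding divided_power_def sum.reindex[OF inj] o_def new sum_distrib_right ..
  finally show ?thesis .
qed

lemma divided_power_commute: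
  assumes "\<And>i. f i * x = x * f i"
  shows "divided_power f m s * x = x * divided_power f m s"
proof (induction m arbitrary: s)
  case 0
  show ?case by (cases s) (simp_all add: divided_power_eq_0)
next
  case (Suc m)
  show ?case
  proof (cases s)
    case (Suc r)
    have "divided_power f m r * f m * x = x * (divided_power f m r * f m)"
      using assms[of m] Suc.IH[of r] by (metis mult.assoc)
    then show ?thesis using Suc.IH by (simp add: Suc divided_power_Suc distrib_left distrib_right)
  qed simp
qed

text \<open>As the \<open>f i\<close> commute and square to zero, each subset of size
  \<open>s + 1\<close> arises once for every choice of the element supplied by the sum, hence
  \<open>s + 1\<close> times. Iteration produces \<open>s!\<close> without any division. The count
  is carried out by induction on \<open>m\<close> along the recursion.\<close>

lemma sum_mult_divided_power:
  assumes "\<And>i j. f i * f j = f j * f i" "\<And>i. f i * f i = 0"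
  shows "(\<Sum>i<m. f i) * divided_power f m s = zmul (int (Suc s)) (divided_power f m (Suc s))"
proof (induction m arbitrary: s)
  case 0
  show ?case by (simp add: divided_power_eq_0)
next
  case (Suc m)
  have comm: "f m * divided_power f m r = divided_power f m r * f m" for r
    using divided_power_commute[of f "f m" m r] assms(1) by simp
  have z: "zmul (int (Suc (Suc r))) x = x + zmul (int (Suc r)) x" for r and x :: 'a
    using zmul_plus1[of "int (Suc r)" x] by (simp add: add.commute)
  show ?case
  proof (cases s)
    case 0
    have "(\<Sum>i<m. f i) = divided_power f m (Suc 0)" using Suc[of 0] by simp
    then show ?thesis by (simp add: 0 divided_power_Suc)
  next
    case (Suc r)
    have "(\<Sum>i<Suc m. f i) * divided_power f (Suc m) s =
        (\<Sum>i<m. f i) * divided_power f m (Suc r) + ((\<Sum>i<m. f i) * divided_power f m r) * f m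
        + (f m * divided_power f m (Suc r) + f m * divided_power f m r * f m)"
      by (simp add: Suc divided_power_Suc distrib_left distrib_right mult.assoc)
    also have "f m * divided_power f m r * f m = 0"
      by (simp add: comm mult.assoc assms(2))
    finally show ?thesis
      by (simp only: Suc.IH comm) (simp only: Suc divided_power_Suc z zmul_add_right zmul_mult_left, simp add: ac_simps)
  qed
qed


section \<open>The diagonal element of a pair of bases\<close>

lemma prod_list_tens:
  fixes a :: "nat \<Rightarrow> 'a::ring_1" and b :: "nat \<Rightarrow> 'b::ring_1"
  shows "prod_list (map (\<lambda>i. a i \<otimes>\<^sub>Z b i) l) = prod_list (map a l) \<otimes>\<^sub>Z prod_list (map b l)"
  by (induction l) (simp_all add: one_tensor_def times_tens)

definition pair_tens :: "(nat \<Rightarrow> 'a::ab_group_add) \<Rightarrow> (nat \<Rightarrow> 'b::ab_group_add) \<Rightarrow> nat \<Rightarrow> ('a ext, 'b ext) tensor" where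
  "pair_tens a b i = ext_of (a i) \<otimes>\<^sub>Z ext_of (b i)"

text \<open>Exchanging the indices changes the sign in both tensor factors, and the two signs
  cancel.\<close>

lemma pair_tens_commute: "pair_tens a b i * pair_tens a b j = pair_tens a b j * pair_tens a b i"
  unfolding pair_tens_def times_tens ext_of_anticommute[of "a i" "a j"] ext_of_anticommute[of "b i" "b j"]
  by (simp add: tens_simps)

lemma pair_tens_square: "pair_tens a b i * pair_tens a b i = 0"
  by (simp add: pair_tens_def times_tens tens_simps)

lemma divided_power_pair_tens:
  "divided_power (pair_tens a b) m s = (\<Sum>S\<in>subsets_of_size m s. basis_wedge a m S \<otimes>\<^sub>Z basis_wedge b m S)"
  unfolding divided_power_def pair_tens_def[abs_def] basis_wedge_def wedge_def prod_list_tens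
  by (simp only: map_map o_def)

lemmas sum_mult_divided_power_pair_tens =
  sum_mult_divided_power[of "pair_tens a b" for a b, OF pair_tens_commute pair_tens_square]

text \<open>A slant product of \<open>t\<close> with the functional sending \<open>u\<close> to
  \<open>v (u * x)\<close>.\<close>

definition contract :: "('a::ab_group_add ext \<Rightarrow> int) \<Rightarrow> ('a ext, 'b::ab_group_add ext) tensor \<Rightarrow> 'a ext \<Rightarrow> 'b ext" where
  "contract v t x = tensor_lift (\<lambda>u w. zmul (v (u * x)) w) t"

lemma biadditive_contract:
  fixes v :: "'a::ring \<Rightarrow> int"
  shows "additive v \<Longrightarrow> biadditive (\<lambda>u w. zmul (v (u * x)) w)"
  by (rule biadditiveI) (simp_all add: additive_def distrib_right zmul_add_left zmul_add_right)

lemma contract_tens: "additive v \<Longrightarrow> contract v (u \<otimes>\<^sub>Z w) x = zmul (v (u * x)) w"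
  by (simp add: contract_def biadditive_contract)

lemma additive_contract: "additive v \<Longrightarrow> additive (\<lambda>t. contract v t x)"
  unfolding contract_def by (intro additive_tensor_lift biadditive_contract)

text \<open>The star sums over all \<open>S\<close>, the divided power only over those of size
  \<open>s\<close>. The volume vanishes unless the size of \<open>S\<close> is complementary to
  \<open>k\<close>, so the sums agree for the complementary \<open>s\<close>, and for any other
  \<open>s\<close> the contraction is zero.\<close>

lemma contract_divided_power:
  assumes "lattice_basis g a" "x \<in> ext_power k"
  shows "contract (volume g a) (divided_power (pair_tens a b) g s) x =
    (if int s + k = int g then hodge g a b x else 0)"
proof -
  note V = volume(1)[OF assms(1)]
  have van: "zmul (volume g a (basis_wedge a g S * x)) (basis_wedge b g S) = 0"
    if "S \<subseteq> {..<g}" "int (card S) + k \<noteq> int g" for S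
    using volume_degree[OF assms(1) ext_power_mult[OF basis_wedge_power[OF that(1)] assms(2)] that(2)]
    by simp
  have eq: "contract (volume g a) (divided_power (pair_tens a b) g s) x =
      (\<Sum>S\<in>subsets_of_size g s. zmul (volume g a (basis_wedge a g S * x)) (basis_wedge b g S))"
    by (simp add: divided_power_pair_tens additive.sum[OF additive_contract[OF V]] contract_tens[OF V])
  show ?thesis
  proof (cases "int s + k = int g")
    case True
    have "(\<Sum>S\<in>subsets_of_size g s. zmul (volume g a (basis_wedge a g S * x)) (basis_wedge b g S)) = hodge g a b x"
      unfolding hodge_def
      by (rule sum.mono_neutral_left) (use True in \<open>auto simp: subsets_of_size_def intro!: van\<close>)
    then show ?thesis using True eq by simp
  next
    case False
    then show ?thesis unfolding eq by (auto simp: subsets_of_size_def intro!: sum.neutral van)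
  qed
qed


section \<open>The exponential of the Chern class\<close>

lemma tensor_lift2:
  assumes R: "\<And>x y. biadditive (f x y)" and L: "\<And>x' y'. biadditive (\<lambda>x y. f x y x' y')"
  shows "biadditive (\<lambda>u v. tensor_lift (\<lambda>x y. tensor_lift (f x y) v) u)"
    and "tensor_lift (\<lambda>x y. tensor_lift (f x y) (x' \<otimes>\<^sub>Z y')) (x \<otimes>\<^sub>Z y) = f x y x' y'"
proof -
  note [simp] = additive.diff[OF additive_tensor_lift[OF R]] R
  have B: "biadditive (\<lambda>x y. tensor_lift (f x y) v)" for v
  proof (rule biadditiveI)
    show "tensor_lift (f (x1 + x2) y) v = tensor_lift (f x1 y) v + tensor_lift (f x2 y) v" for x1 x2 y
      by (induction v) (simp_all, simp add: biadditiveD(1)[OF L])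
    show "tensor_lift (f x (y1 + y2)) v = tensor_lift (f x y1) v + tensor_lift (f x y2) v" for x y1 y2
      by (induction v) (simp_all, simp add: biadditiveD(2)[OF L])
  qed
  show "tensor_lift (\<lambda>x y. tensor_lift (f x y) (x' \<otimes>\<^sub>Z y')) (x \<otimes>\<^sub>Z y) = f x y x' y'"
    by (subst tensor_lift_tens[OF B]) simp
  show "biadditive (\<lambda>u v. tensor_lift (\<lambda>x y. tensor_lift (f x y) v) u)"
  proof (rule biadditiveI)
    fix u u' v v'
    show "tensor_lift (\<lambda>x y. tensor_lift (f x y) v) (u + u') =
        tensor_lift (\<lambda>x y. tensor_lift (f x y) v) u + tensor_lift (\<lambda>x y. tensor_lift (f x y) v) u'"
      by (rule additive.add[OF additive_tensor_lift[OF B]])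
    show "tensor_lift (\<lambda>x y. tensor_lift (f x y) (v + v')) u =
        tensor_lift (\<lambda>x y. tensor_lift (f x y) v) u + tensor_lift (\<lambda>x y. tensor_lift (f x y) v') u"
      by (induction u)
        (simp_all only: tensor_lift_tens[OF B] additive.diff[OF additive_tensor_lift[OF B]],
          simp_all add: additive.add[OF additive_tensor_lift[OF R]])
  qed
qed

text \<open>The diagonal elements pair a lattice with its dual, whereas the Kuenneth product pairs
  the two tori; this map regroups the four factors. It carries no sign: the Kuenneth sign is
  accounted for when multiplying by the Chern class.\<close>

definition kunneth_join :: "('a::ab_group_add ext, 'd::ab_group_add ext) tensor
    \<Rightarrow> ('b::ab_group_add ext, 'c::ab_group_add ext) tensor \<Rightarrow> (('a, 'b) coh, ('c, 'd) coh) tensor" where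
  "kunneth_join u v = tensor_lift (\<lambda>\<alpha> \<mu>. tensor_lift (\<lambda>\<omega> \<nu>. (\<alpha> \<otimes>\<^sub>Z \<omega>) \<otimes>\<^sub>Z (\<nu> \<otimes>\<^sub>Z \<mu>)) v) u"

lemma biadditive_kunneth_join: "biadditive kunneth_join"
  unfolding kunneth_join_def[abs_def]
  by (rule tensor_lift2(1); rule biadditiveI) (simp_all add: tens_simps)

lemma kunneth_join_tens:
  "kunneth_join (\<alpha> \<otimes>\<^sub>Z \<mu>) (\<omega> \<otimes>\<^sub>Z \<nu>) = (\<alpha> \<otimes>\<^sub>Z \<omega>) \<otimes>\<^sub>Z (\<nu> \<otimes>\<^sub>Z \<mu>)"
  unfolding kunneth_join_def
  by (rule tensor_lift2(2)[where f = "\<lambda>\<alpha> \<mu> \<omega> \<nu>. (\<alpha> \<otimes>\<^sub>Z \<omega>) \<otimes>\<^sub>Z (\<nu> \<otimes>\<^sub>Z \<mu>)"]; rule biadditiveI)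
    (simp_all add: tens_simps)

lemma one_ext_power: "1 \<in> ext_power 0"
  unfolding ext_power_def by (rule group_closure_base) (force intro: exI[of _ "[]"])

lemma ext_of_ext_power: "ext_of x \<in> ext_power 1"
  unfolding ext_power_def by (rule group_closure_base) (force intro: exI[of _ "[x]"])

lemma wedge_ext_power: "wedge xs \<in> ext_power (int (length xs))"
  unfolding ext_power_def by (rule group_closure_base) blast

lemma tens_trop_coh: "\<alpha> \<in> ext_power q \<Longrightarrow> \<omega> \<in> ext_power p \<Longrightarrow> \<alpha> \<otimes>\<^sub>Z \<omega> \<in> trop_coh p q"
  unfolding trop_coh_def by (rule group_closure_base) blast

text \<open>Every summand of the Chern class has total degree 1 on \<open>X\<close>, and the factor
  on the dual torus has total degree \<open>s + t\<close>. So all summands meet the same Kuenneth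
  sign, and the remaining products are the unsigned ones of the two diagonal elements.\<close>

lemma poincare_chern_join_tens:
  assumes "\<mu> \<in> ext_power (int s)" "\<nu> \<in> ext_power (int t)"
  shows "kunneth_mult (poincare_chern g lam eta) (kunneth_join (\<alpha> \<otimes>\<^sub>Z \<mu>) (\<omega> \<otimes>\<^sub>Z \<nu>)) =
    zmul (- ((-1) ^ (s + t)))
      (kunneth_join ((\<Sum>i<g. pair_tens (dual_basis g lam) lam i) * (\<alpha> \<otimes>\<^sub>Z \<mu>)) (\<omega> \<otimes>\<^sub>Z \<nu>) +
       kunneth_join (\<alpha> \<otimes>\<^sub>Z \<mu>) ((\<Sum>i<g. pair_tens (dual_basis g eta) eta i) * (\<omega> \<otimes>\<^sub>Z \<nu>)))"
proof -
  let ?z = "kunneth_join (\<alpha> \<otimes>\<^sub>Z \<mu>) (\<omega> \<otimes>\<^sub>Z \<nu>)"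
  have deg: "\<nu> \<otimes>\<^sub>Z \<mu> \<in> trop_coh (int s) (int t)"
    by (rule tens_trop_coh[OF assms(2,1)])
  note K = biadditive_kunneth_mult
  note J = biadditive_kunneth_join
  have addK: "additive (\<lambda>u. kunneth_mult u ?z)" and addJ1: "additive (\<lambda>u. kunneth_join u (\<omega> \<otimes>\<^sub>Z \<nu>))"
    and addJ2: "additive (\<lambda>v. kunneth_join (\<alpha> \<otimes>\<^sub>Z \<mu>) v)"
    using K J by (auto simp: biadditive_def)
  \<comment> \<open>Terms from \<open>eta\<close> act on the second pair only; those from
    \<open>lam\<close>, treated next, on the first.\<close>
  have N: "kunneth_mult ((1 \<otimes>\<^sub>Z ext_of x) \<otimes>\<^sub>Z (ext_of y \<otimes>\<^sub>Z 1)) ?z =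
      zmul ((-1) ^ (s + t)) (kunneth_join (\<alpha> \<otimes>\<^sub>Z \<mu>) ((ext_of x \<otimes>\<^sub>Z ext_of y) * (\<omega> \<otimes>\<^sub>Z \<nu>)))" for x y
    unfolding kunneth_join_tens times_tens
    by (subst kunneth_mult_homogeneous[where p = 1 and q = 0, OF _ deg])
      (simp_all add: tens_trop_coh one_ext_power ext_of_ext_power times_tens)
  have L: "kunneth_mult ((ext_of x \<otimes>\<^sub>Z 1) \<otimes>\<^sub>Z (1 \<otimes>\<^sub>Z ext_of y)) ?z =
      zmul ((-1) ^ (s + t)) (kunneth_join ((ext_of x \<otimes>\<^sub>Z ext_of y) * (\<alpha> \<otimes>\<^sub>Z \<mu>)) (\<omega> \<otimes>\<^sub>Z \<nu>))" for x y
    unfolding kunneth_join_tens times_tens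
    by (subst kunneth_mult_homogeneous[where p = 0 and q = 1, OF _ deg])
      (simp_all add: tens_trop_coh one_ext_power ext_of_ext_power times_tens)
  show ?thesis
    unfolding poincare_chern_def
    by (simp add: biadditiveD[OF K] additive.sum[OF addK] N L pair_tens_def sum_distrib_right
        additive.sum[OF addJ1] additive.sum[OF addJ2] additive.sum[OF additive_zmul] zmul_add_right sum_negf)
qed

text \<open>The sign depends on \<open>s\<close> and \<open>t\<close> alone, so the formula extends
  additively to sums whose factors on the dual torus have these degrees.\<close>

lemma poincare_chern_join:
  fixes lam :: "nat \<Rightarrow> 'l::ab_group_add" and eta :: "nat \<Rightarrow> 'n::ab_group_add"
  assumes "u \<in> group_closure {\<alpha> \<otimes>\<^sub>Z \<mu> | \<alpha> \<mu>. \<mu> \<in> ext_power (int s)}"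
    and "v \<in> group_closure {\<omega> \<otimes>\<^sub>Z \<nu> | \<omega> \<nu>. \<nu> \<in> ext_power (int t)}"
  shows "kunneth_mult (poincare_chern g lam eta) (kunneth_join u v) =
    zmul (- ((-1) ^ (s + t)))
      (kunneth_join ((\<Sum>i<g. pair_tens (dual_basis g lam) lam i) * u) v +
       kunneth_join u ((\<Sum>i<g. pair_tens (dual_basis g eta) eta i) * v))"
proof -
  note simps = additive_def biadditiveD(1,2)[OF biadditive_kunneth_join] distrib_left zmul_add_right
    biadditiveD(2)[OF biadditive_kunneth_mult] ac_simps
  show ?thesis
  proof (rule additive_eq_on_group_closure[OF _ _ _ assms(1)])
    fix x :: "('l zdual ext, 'l ext) tensor" assume "x \<in> {\<alpha> \<otimes>\<^sub>Z \<mu> | \<alpha> \<mu>. \<mu> \<in> ext_power (int s)}"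
    then obtain \<alpha> \<mu> where x: "x = \<alpha> \<otimes>\<^sub>Z \<mu>" "\<mu> \<in> ext_power (int s)" by blast
    show "kunneth_mult (poincare_chern g lam eta) (kunneth_join x v) =
      zmul (- ((-1) ^ (s + t)))
        (kunneth_join ((\<Sum>i<g. pair_tens (dual_basis g lam) lam i) * x) v +
         kunneth_join x ((\<Sum>i<g. pair_tens (dual_basis g eta) eta i) * v))"
    proof (rule additive_eq_on_group_closure[OF _ _ _ assms(2)])
      fix y :: "('n zdual ext, 'n ext) tensor" assume "y \<in> {\<omega> \<otimes>\<^sub>Z \<nu> | \<omega> \<nu>. \<nu> \<in> ext_power (int t)}"
      then obtain \<omega> \<nu> where "y = \<omega> \<otimes>\<^sub>Z \<nu>" "\<nu> \<in> ext_power (int t)" by blast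
      then show "kunneth_mult (poincare_chern g lam eta) (kunneth_join x y) =
        zmul (- ((-1) ^ (s + t)))
          (kunneth_join ((\<Sum>i<g. pair_tens (dual_basis g lam) lam i) * x) y +
           kunneth_join x ((\<Sum>i<g. pair_tens (dual_basis g eta) eta i) * y))"
        unfolding x(1) by (simp only: poincare_chern_join_tens[OF x(2)])
    qed (simp_all add: simps)
  qed (simp_all add: simps)
qed

text \<open>Multiplying by the Chern class once more costs \<open>-(-1)\<^sup>j\<close> in degree \<open>j\<close>: the sign of the Chern
  class, and the Kuenneth sign for moving a class of degree 1 past one of degree \<open>j\<close>.\<close>

definition power_sign :: "nat \<Rightarrow> int" where
  "power_sign k = (\<Prod>j<k. - ((-1) ^ j))"

lemma power_sign_square: "power_sign k * power_sign k = 1"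
  unfolding power_sign_def prod.distrib[symmetric]
  by (rule prod.neutral) (auto simp: power_mult_distrib[symmetric])

text \<open>An integral model of the \<open>k\<close>-th power of the Chern class divided by
  \<open>k!\<close>: each summand takes \<open>s\<close> factors from the \<open>lam\<close> part
  and \<open>k - s\<close> from the \<open>eta\<close> part.\<close>

definition chern_divided_power :: "nat \<Rightarrow> (nat \<Rightarrow> 'l::ab_group_add) \<Rightarrow> (nat \<Rightarrow> 'n::ab_group_add) \<Rightarrow> nat
    \<Rightarrow> (('l zdual, 'n zdual) coh, ('n, 'l) coh) tensor" where
  "chern_divided_power g lam eta k = zmul (power_sign k) (\<Sum>s\<le>k.
     kunneth_join (divided_power (pair_tens (dual_basis g lam) lam) g s)
       (divided_power (pair_tens (dual_basis g eta) eta) g (k - s)))"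

lemma divided_power_degree:
  "divided_power (pair_tens a b) g s \<in> group_closure {\<alpha> \<otimes>\<^sub>Z \<mu> | \<alpha> \<mu>. \<mu> \<in> ext_power (int s)}"
  unfolding divided_power_pair_tens
proof (rule group_closure_sum, rule group_closure_base)
  fix S assume "S \<in> subsets_of_size g s"
  then have "basis_wedge b g S \<in> ext_power (int s)"
    using basis_wedge_power[of S g b] by (auto simp: subsets_of_size_def)
  then show "basis_wedge a g S \<otimes>\<^sub>Z basis_wedge b g S \<in> {\<alpha> \<otimes>\<^sub>Z \<mu> | \<alpha> \<mu>. \<mu> \<in> ext_power (int s)}"
    by blast
qed

text \<open>The term with index \<open>s\<close> in the result arises from index
  \<open>s - 1\<close> with coefficient \<open>s\<close> and from index \<open>s\<close> with
  coefficient \<open>k + 1 - s\<close>, in total \<open>k + 1\<close> times.\<close>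

lemma poincare_chern_mult:
  "kunneth_mult (poincare_chern g lam eta) (chern_divided_power g lam eta k) =
     zmul (int (Suc k)) (chern_divided_power g lam eta (Suc k))"
proof -
  let ?A = "divided_power (pair_tens (dual_basis g lam) lam) g"
  let ?B = "divided_power (pair_tens (dual_basis g eta) eta) g"
  let ?F = "\<lambda>s. kunneth_join (?A s) (?B (Suc k - s))"
  have addK: "additive (kunneth_mult (poincare_chern g lam eta))"
    and addJ1: "\<And>v. additive (\<lambda>u. kunneth_join u v)" and addJ2: "\<And>u. additive (kunneth_join u)"
    using biadditive_kunneth_mult biadditive_kunneth_join by (auto simp: biadditive_def)
  have step: "kunneth_mult (poincare_chern g lam eta) (kunneth_join (?A s) (?B (k - s))) =
      zmul (- ((-1) ^ k)) (zmul (int (Suc s)) (?F (Suc s)) + zmul (int (Suc k - s)) (?F s))"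
    if "s \<le> k" for s
    using that poincare_chern_join[OF divided_power_degree divided_power_degree, of g lam eta _ _ _ s _ _ _ "k - s"]
    by (simp add: sum_mult_divided_power_pair_tens zmul_additive[OF addJ1] zmul_additive[OF addJ2]
        Suc_diff_le del: of_nat_Suc)
  \<comment> \<open>Both sums are extended to the range up to \<open>Suc k\<close>: the term added
    here is \<open>s = 0\<close>, in the next sum \<open>s = Suc k\<close>, and each has coefficient
    zero.\<close>
  have "(\<Sum>s\<le>k. zmul (int (Suc s)) (?F (Suc s))) = (\<Sum>s\<le>Suc k. zmul (int s) (?F s))"
    by (subst sum.atMost_Suc_shift) simp
  moreover have "(\<Sum>s\<le>k. zmul (int (Suc k - s)) (?F s)) = (\<Sum>s\<le>Suc k. zmul (int (Suc k - s)) (?F s))"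
    by simp
  moreover have "(\<Sum>s\<le>Suc k. zmul (int s) (?F s)) + (\<Sum>s\<le>Suc k. zmul (int (Suc k - s)) (?F s)) =
      zmul (int (Suc k)) (\<Sum>s\<le>Suc k. ?F s)"
    unfolding additive.sum[OF additive_zmul] sum.distrib[symmetric]
    by (rule sum.cong) (auto simp: zmul_add_left[symmetric] of_nat_diff)
  ultimately have total: "(\<Sum>s\<le>k. zmul (int (Suc s)) (?F (Suc s)) + zmul (int (Suc k - s)) (?F s)) =
      zmul (int (Suc k)) (\<Sum>s\<le>Suc k. ?F s)"
    by (simp only: sum.distrib)
  have "kunneth_mult (poincare_chern g lam eta) (chern_divided_power g lam eta k) =
      zmul (power_sign k) (\<Sum>s\<le>k. zmul (- ((-1) ^ k))
        (zmul (int (Suc s)) (?F (Suc s)) + zmul (int (Suc k - s)) (?F s)))"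
    unfolding chern_divided_power_def zmul_additive[OF addK] additive.sum[OF addK]
    by (rule arg_cong[where f = "zmul _"], rule sum.cong[OF refl], rule step) simp
  also have "\<dots> = zmul (power_sign k * - ((-1) ^ k)) (zmul (int (Suc k)) (\<Sum>s\<le>Suc k. ?F s))"
    unfolding additive.sum[OF additive_zmul, symmetric] total zmul_zmul by (simp only: mult.assoc)
  also have "\<dots> = zmul (int (Suc k)) (chern_divided_power g lam eta (Suc k))"
    unfolding chern_divided_power_def zmul_zmul by (simp add: power_sign_def mult.commute)
  finally show ?thesis .
qed

lemma poincare_chern_power:
  "(kunneth_mult (poincare_chern g lam eta) ^^ k) (1 \<otimes>\<^sub>Z 1) = zmul (fact k) (chern_divided_power g lam eta k)"
proof (induction k)
  case 0
  show ?case
    by (simp add: chern_divided_power_def power_sign_def one_tensor_def kunneth_join_tens)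
next
  case (Suc k)
  have addK: "additive (kunneth_mult (poincare_chern g lam eta))"
    using biadditive_kunneth_mult by (auto simp: biadditive_def)
  show ?case
    by (simp add: Suc zmul_additive[OF addK] poincare_chern_mult zmul_zmul mult.commute del: of_nat_Suc)
qed

text \<open>One of \<open>s\<close> and \<open>k - s\<close> exceeds \<open>g\<close>, where no
  index subsets are left. This gives the exponential series finite support.\<close>

lemma chern_divided_power_eq_0:
  assumes "2 * g < k"
  shows "chern_divided_power g lam eta k = 0"
proof -
  have "kunneth_join (divided_power (pair_tens (dual_basis g lam) lam) g s)
       (divided_power (pair_tens (dual_basis g eta) eta) g (k - s)) = 0" for s
  proof (cases "g < s")
    case False
    then have "g < k - s" using assms by simp
    then show ?thesis by (simp add: divided_power_eq_0 biadditiveD[OF biadditive_kunneth_join])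
  qed (simp add: divided_power_eq_0 biadditiveD[OF biadditive_kunneth_join])
  then show ?thesis by (simp add: chern_divided_power_def)
qed

section \<open>Rational coefficients\<close>

lemma additive_rat_incl: "additive rat_incl"
  by (simp add: additive_def rat_incl_def tens_simps)

lemma rat_map_incl: "additive f \<Longrightarrow> rat_map f (rat_incl x) = rat_incl (f x)"
  by (simp add: rat_map_def rat_incl_def additive_id)

lemma rat_bimap_incl:
  assumes "biadditive m"
  shows "rat_bimap m (rat_incl x) (rat_incl y) = rat_incl (m x y)"
proof -
  have "rat_bimap m (x \<otimes>\<^sub>Z 1) (y \<otimes>\<^sub>Z 1) = m x y \<otimes>\<^sub>Z (1 * 1)"
    unfolding rat_bimap_def
    by (rule tensor_lift2(2)[where f = "\<lambda>x r y s. m x y \<otimes>\<^sub>Z (r * s)"]; rule biadditiveI)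
      (simp_all add: biadditiveD[OF assms] tens_simps distrib_left distrib_right)
  then show ?thesis by (simp add: rat_incl_def)
qed

text \<open>The integer crosses the tensor sign into the rational factor, where it is
  cancelled.\<close>

lemma rat_scale_zmul:
  assumes "n \<noteq> 0"
  shows "rat_scale (1 / of_int n) (rat_incl (zmul n x)) = rat_incl x"
proof -
  have z: "zmul n r = of_int n * r" for r :: rat
    by (induction n rule: int_induct[where k = 0])
      (simp_all add: zmul_plus1 zmul_minus1 algebra_simps)
  have "additive (\<lambda>x. x \<otimes>\<^sub>Z (1 :: rat))" "additive (\<lambda>r :: rat. x \<otimes>\<^sub>Z r)"
    by (simp_all add: additive_def tens_simps)
  then have "zmul n x \<otimes>\<^sub>Z (1 :: rat) = x \<otimes>\<^sub>Z zmul n 1"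
    using zmul_additive by metis
  then have "rat_incl (zmul n x) = x \<otimes>\<^sub>Z of_int n" by (simp add: rat_incl_def z)
  then show ?thesis
    using assms by (simp add: rat_scale_def rat_incl_def additive_id additive_mult_left)
qed

text \<open>The denominators cancel against the factorials of \<open>poincare_chern_power\<close>,
  so the exponential comes from an integral class. This is why the transform preserves integral
  cohomology.\<close>

lemma kunneth_exp_chern:
  "kunneth_exp (rat_incl (poincare_chern g lam eta)) = rat_incl (\<Sum>k\<le>2 * g. chern_divided_power g lam eta k)"
proof -
  let ?E = "poincare_chern g lam eta"
  have pow: "(rat_bimap kunneth_mult (rat_incl ?E) ^^ k) (rat_incl z) = rat_incl ((kunneth_mult ?E ^^ k) z)" for k z
    by (induction k) (simp_all add: rat_bimap_incl[OF biadditive_kunneth_mult])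
  have "rat_scale (1 / fact k) ((rat_bimap kunneth_mult (rat_incl ?E) ^^ k) (rat_incl (1 \<otimes>\<^sub>Z 1))) =
      rat_incl (chern_divided_power g lam eta k)" for k
    using rat_scale_zmul[of "fact k" "chern_divided_power g lam eta k"]
    by (simp add: pow poincare_chern_power)
  then have "kunneth_exp (rat_incl ?E) = Sum_any (\<lambda>k. rat_incl (chern_divided_power g lam eta k))"
    by (simp add: kunneth_exp_def)
  also have "\<dots> = (\<Sum>k\<le>2 * g. rat_incl (chern_divided_power g lam eta k))"
  proof (rule Sum_any.expand_superset)
    show "{k. rat_incl (chern_divided_power g lam eta k) \<noteq> 0} \<subseteq> {..2 * g}"
      using chern_divided_power_eq_0[of g _ lam eta] additive.zero[OF additive_rat_incl]
      by (force simp: not_le[symmetric])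
  qed simp
  finally show ?thesis by (simp add: additive.sum[OF additive_rat_incl])
qed


section \<open>The transform on integral cohomology\<close>

text \<open>The sign is trivial because the pullback has the degree 0 class on the dual torus. The
  product formula is available for homogeneous classes, so \<open>x\<close> is first reduced to
  tensors of words.\<close>

lemma kunneth_mult_pull1: "kunneth_mult (x \<otimes>\<^sub>Z y) (pull1 x') = (x * x') \<otimes>\<^sub>Z y"
proof -
  have addK: "additive (\<lambda>x. kunneth_mult (x \<otimes>\<^sub>Z y) (pull1 x'))"
    by (simp add: additive_def tens_simps biadditiveD[OF biadditive_kunneth_mult])
  have addR: "additive (\<lambda>x. (x * x') \<otimes>\<^sub>Z y)"
    by (simp add: additive_def tens_simps distrib_right)
  have one: "1 \<in> trop_coh (int 0) (int 0)"
    unfolding one_tensor_def by (simp add: tens_trop_coh one_ext_power)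
  have words: "kunneth_mult ((wedge xs \<otimes>\<^sub>Z wedge ys) \<otimes>\<^sub>Z y) (pull1 x') = ((wedge xs \<otimes>\<^sub>Z wedge ys) * x') \<otimes>\<^sub>Z y" for xs ys
    using kunneth_mult_homogeneous[OF tens_trop_coh[OF wedge_ext_power wedge_ext_power] one]
    by (simp add: pull1_def)
  show ?thesis
  proof (induction x)
    case (tens \<alpha> \<omega>)
    show ?case
    proof (induction \<alpha>)
      case (wedge xs)
      show ?case
        by (induction \<omega>) (simp_all only: words tens_simps(4) additive.diff[OF addK] additive.diff[OF addR])
    qed (simp only: tens_simps(3)[where b = \<omega>] additive.diff[OF addK] additive.diff[OF addR])
  qed (simp only: additive.diff[OF addK] additive.diff[OF addR])
qed

text \<open>The projection to bidegree \<open>(g, g)\<close> is the product of the two volumes times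
  the top class. The coefficient is unique because the same functional takes the value 1 on the top
  class.\<close>

lemma delta_eq:
  fixes lam :: "nat \<Rightarrow> 'l::ab_group_add" and eta :: "nat \<Rightarrow> 'n::ab_group_add"
  assumes "lattice_basis g lam" "lattice_basis g eta"
  shows "delta g lam eta =
    tensor_lift (\<lambda>\<alpha> \<omega>. volume g (dual_basis g lam) \<alpha> * volume g (dual_basis g eta) \<omega>)"
proof
  let ?a = "dual_basis g lam" and ?b = "dual_basis g eta"
  let ?D = "tensor_lift (\<lambda>\<alpha> \<omega>. volume g ?a \<alpha> * volume g ?b \<omega>)"
  note a = lattice_basis_dual_basis[OF assms(1)] and b = lattice_basis_dual_basis[OF assms(2)]
  have bi: "biadditive (\<lambda>\<alpha> \<omega>. volume g ?a \<alpha> * volume g ?b \<omega>)"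
    by (rule biadditiveI)
      (simp_all add: additive.add[OF volume(1)[OF a]] additive.add[OF volume(1)[OF b]] distrib_left distrib_right)
  note D = additive_tensor_lift[OF bi]
  have L: "zmul m \<alpha> \<otimes>\<^sub>Z zmul n \<omega> = zmul (m * n) (\<alpha> \<otimes>\<^sub>Z \<omega>)" for m n and \<alpha> :: "'l zdual ext" and \<omega> :: "'n zdual ext"
    using zmul_additive[of "\<lambda>\<alpha>. \<alpha> \<otimes>\<^sub>Z zmul n \<omega>" m \<alpha>] zmul_additive[of "\<lambda>\<omega>. \<alpha> \<otimes>\<^sub>Z \<omega>" n \<omega>]
    by (simp add: additive_def tens_simps zmul_zmul)
  have proj: "coh_proj g g x = zmul (?D x) (top_class g lam eta)" for x
  proof (rule tensor_additive_eqI[OF additive_coh_proj])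
    show "additive (\<lambda>x. zmul (?D x) (top_class g lam eta))"
      by (rule additive_zmul_left[OF D])
    show "coh_proj g g (\<alpha> \<otimes>\<^sub>Z \<omega>) = zmul (?D (\<alpha> \<otimes>\<^sub>Z \<omega>)) (top_class g lam eta)" for \<alpha> \<omega>
      by (simp add: coh_proj_def additive_ext_proj bi ext_proj_top[OF a] ext_proj_top[OF b] L top_class_def)
  qed
  have full: "basis_wedge c g {..<g} = wedge (map c [0..<g])" for c :: "nat \<Rightarrow> 'c::ab_group_add"
    by (simp add: basis_wedge_def cong: filter_cong)
  have top: "?D (top_class g lam eta) = 1"
    using volume_basis_wedge[OF a subset_refl] volume_basis_wedge[OF b subset_refl]
    by (simp add: top_class_def bi full)
  fix x
  show "delta g lam eta x = ?D x"
    unfolding delta_def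
  proof (rule the_equality)
    show "coh_proj g g x = zmul (?D x) (top_class g lam eta)" by (rule proj)
    fix n assume "coh_proj g g x = zmul n (top_class g lam eta)"
    then have "?D (zmul n (top_class g lam eta)) = ?D (zmul (?D x) (top_class g lam eta))"
      using proj by simp
    then show "n = ?D x" by (simp add: zmul_additive[OF D] top)
  qed
qed

lemma
  assumes "lattice_basis g lam" "lattice_basis g eta"
  shows additive_push2: "additive (push2 g lam eta)"
    and push2_tens: "push2 g lam eta ((\<alpha> \<otimes>\<^sub>Z \<omega>) \<otimes>\<^sub>Z y) =
      zmul (volume g (dual_basis g lam) \<alpha> * volume g (dual_basis g eta) \<omega>) y"
proof -
  let ?a = "dual_basis g lam" and ?b = "dual_basis g eta"
  note a = lattice_basis_dual_basis[OF assms(1)] and b = lattice_basis_dual_basis[OF assms(2)]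
  have bi: "biadditive (\<lambda>\<alpha> \<omega>. volume g ?a \<alpha> * volume g ?b \<omega>)"
    by (rule biadditiveI)
      (simp_all add: additive.add[OF volume(1)[OF a]] additive.add[OF volume(1)[OF b]] distrib_left distrib_right)
  have *: "biadditive (\<lambda>x y. zmul (delta g lam eta x) y)"
    by (rule biadditiveI) (simp_all add: delta_eq[OF assms] additive.add[OF additive_tensor_lift[OF bi]]
        zmul_add_left zmul_add_right)
  show "additive (push2 g lam eta)"
    unfolding push2_def by (rule additive_tensor_lift[OF *])
  show "push2 g lam eta ((\<alpha> \<otimes>\<^sub>Z \<omega>) \<otimes>\<^sub>Z y) = zmul (volume g ?a \<alpha> * volume g ?b \<omega>) y"
    by (simp add: push2_def *) (simp add: delta_eq[OF assms] bi)
qed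

text \<open>On elementary tensors the two volumes produced by the push-forward are the coefficients
  of the two contractions. The contraction of \<open>v\<close> comes first since \<open>N\<close>
  precedes the other lattice on the dual torus.\<close>

lemma push2_kunneth_join:
  fixes lam :: "nat \<Rightarrow> 'l::ab_group_add" and eta :: "nat \<Rightarrow> 'n::ab_group_add"
  assumes "lattice_basis g lam" "lattice_basis g eta"
  shows "push2 g lam eta (kunneth_mult (kunneth_join u v) (pull1 (\<alpha> \<otimes>\<^sub>Z \<omega>))) =
    contract (volume g (dual_basis g eta)) v \<omega> \<otimes>\<^sub>Z contract (volume g (dual_basis g lam)) u \<alpha>"
proof -
  let ?a = "dual_basis g lam" and ?b = "dual_basis g eta"
  note a = lattice_basis_dual_basis[OF assms(1)] and b = lattice_basis_dual_basis[OF assms(2)]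
  note C = additive_contract[OF volume(1)[OF a]] additive_contract[OF volume(1)[OF b]]
  note simps = additive_def additive.add[OF additive_push2[OF assms]]
    biadditiveD[OF biadditive_kunneth_join] biadditiveD[OF biadditive_kunneth_mult] tens_simps
    additive.add[OF C(1)] additive.add[OF C(2)]
  show ?thesis
  proof (rule tensor_additive_eqI[where t = u])
    fix \<alpha>' :: "'l zdual ext" and \<mu> :: "'l ext"
    show "push2 g lam eta (kunneth_mult (kunneth_join (\<alpha>' \<otimes>\<^sub>Z \<mu>) v) (pull1 (\<alpha> \<otimes>\<^sub>Z \<omega>))) =
      contract (volume g ?b) v \<omega> \<otimes>\<^sub>Z contract (volume g ?a) (\<alpha>' \<otimes>\<^sub>Z \<mu>) \<alpha>"
    proof (rule tensor_additive_eqI[where t = v])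
      fix \<omega>' :: "'n zdual ext" and \<nu> :: "'n ext"
      have "zmul m \<nu> \<otimes>\<^sub>Z zmul n \<mu> = zmul (n * m) (\<nu> \<otimes>\<^sub>Z \<mu>)" for m n
        using zmul_additive[of "\<lambda>\<nu>. \<nu> \<otimes>\<^sub>Z zmul n \<mu>" m \<nu>] zmul_additive[of "\<lambda>\<mu>. \<nu> \<otimes>\<^sub>Z \<mu>" n \<mu>]
        by (simp add: additive_def tens_simps zmul_zmul mult.commute)
      then show "push2 g lam eta (kunneth_mult (kunneth_join (\<alpha>' \<otimes>\<^sub>Z \<mu>) (\<omega>' \<otimes>\<^sub>Z \<nu>)) (pull1 (\<alpha> \<otimes>\<^sub>Z \<omega>))) =
        contract (volume g ?b) (\<omega>' \<otimes>\<^sub>Z \<nu>) \<omega> \<otimes>\<^sub>Z contract (volume g ?a) (\<alpha>' \<otimes>\<^sub>Z \<mu>) \<alpha>"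
        by (simp add: kunneth_join_tens kunneth_mult_pull1 times_tens push2_tens[OF assms]
            contract_tens[OF volume(1)[OF a]] contract_tens[OF volume(1)[OF b]])
    qed (simp_all add: simps)
  qed (simp_all add: simps)
qed

text \<open>No word has negative length, so the generating set is empty.\<close>

lemma ext_power_negative: "k < 0 \<Longrightarrow> x \<in> ext_power k \<Longrightarrow> x = 0"
  unfolding ext_power_def using additive_zero_on_group_closure[OF additive_id] by force

text \<open>The contractions force \<open>s + q = g\<close> and \<open>k - s + p = g\<close>. Hence
  a single pair \<open>k = 2 * g - p - q\<close>, \<open>s = g - q\<close> can contribute, and its
  sign is constant on the bidegree.\<close>

lemma integral_transform_tens:
  assumes "lattice_basis g lam" "lattice_basis g eta" "\<alpha> \<in> ext_power (int q)" "\<omega> \<in> ext_power (int p)"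
  shows "push2 g lam eta (kunneth_mult (\<Sum>k\<le>2 * g. chern_divided_power g lam eta k) (pull1 (\<alpha> \<otimes>\<^sub>Z \<omega>))) =
    zmul (power_sign (2 * g - p - q))
      (hodge g (dual_basis g eta) eta \<omega> \<otimes>\<^sub>Z hodge g (dual_basis g lam) lam \<alpha>)"
proof -
  let ?a = "dual_basis g lam" and ?b = "dual_basis g eta"
  let ?A = "divided_power (pair_tens ?a lam) g" and ?B = "divided_power (pair_tens ?b eta) g"
  let ?h = "hodge g ?b eta \<omega> \<otimes>\<^sub>Z hodge g ?a lam \<alpha>"
  note a = lattice_basis_dual_basis[OF assms(1)] and b = lattice_basis_dual_basis[OF assms(2)]
  have add: "additive (\<lambda>z. push2 g lam eta (kunneth_mult z (pull1 (\<alpha> \<otimes>\<^sub>Z \<omega>))))"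
    by (simp add: additive_def additive.add[OF additive_push2[OF assms(1,2)]] biadditiveD[OF biadditive_kunneth_mult])
  have expand: "push2 g lam eta (kunneth_mult (\<Sum>k\<le>2 * g. chern_divided_power g lam eta k) (pull1 (\<alpha> \<otimes>\<^sub>Z \<omega>))) =
      (\<Sum>k\<le>2 * g. zmul (power_sign k) (\<Sum>s\<le>k. if k - s + p = g \<and> s + q = g then ?h else 0))"
    unfolding additive.sum[OF add] chern_divided_power_def zmul_additive[OF add]
  proof (rule sum.cong[OF refl], rule arg_cong[where f = "zmul _"], rule sum.cong[OF refl])
    fix k s
    show "push2 g lam eta (kunneth_mult (kunneth_join (?A s) (?B (k - s))) (pull1 (\<alpha> \<otimes>\<^sub>Z \<omega>))) =
        (if k - s + p = g \<and> s + q = g then ?h else 0)"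
      unfolding push2_kunneth_join[OF assms(1,2)] contract_divided_power[OF a assms(3)]
        contract_divided_power[OF b assms(4)] of_nat_add[symmetric] of_nat_eq_iff
      by (auto simp: tens_simps)
  qed
  show ?thesis
  proof (cases "p \<le> g \<and> q \<le> g")
    case True
    have "(\<Sum>s\<le>k. if k - s + p = g \<and> s + q = g then ?h else 0) = (if k = 2 * g - p - q then ?h else 0)" for k
    proof (cases "k = 2 * g - p - q")
      case k: True
      have iff: "k - s + p = g \<and> s + q = g \<longleftrightarrow> s = g - q" if "s \<in> {..k}" for s
        using that True k unfolding atMost_iff by arith
      have "(\<Sum>s\<le>k. if k - s + p = g \<and> s + q = g then ?h else 0) = (\<Sum>s\<le>k. if s = g - q then ?h else 0)"
        by (rule sum.cong[OF refl]) (simp only: iff)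
      also have "g - q \<le> k" using True k by arith
      then have "(\<Sum>s\<le>k. if s = g - q then ?h else 0) = ?h" by simp
      finally show ?thesis unfolding if_P[OF k] .
    next
      case False
      have "\<not> (k - s + p = g \<and> s + q = g)" if "s \<in> {..k}" for s
        using that True False unfolding atMost_iff by arith
      then have "(\<Sum>s\<le>k. if k - s + p = g \<and> s + q = g then ?h else 0) = (\<Sum>s\<le>k. 0)"
        by (intro sum.cong[OF refl]) (simp only: if_False)
      then show ?thesis using False by simp
    qed
    then have "push2 g lam eta (kunneth_mult (\<Sum>k\<le>2 * g. chern_divided_power g lam eta k) (pull1 (\<alpha> \<otimes>\<^sub>Z \<omega>))) =
        (\<Sum>k\<le>2 * g. if k = 2 * g - p - q then zmul (power_sign k) ?h else 0)"
      unfolding expand by (intro sum.cong) auto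
    then show ?thesis by simp
  next
    case False
    \<comment> \<open>Here \<open>p\<close> or \<open>q\<close> exceeds \<open>g\<close>, so one of
      the stars lands in a negative exterior power. Both sides vanish, whatever the truncated
      difference \<open>2 * g - p - q\<close> is.\<close>
    have "?h = 0"
    proof (cases "p \<le> g")
      case True
      then have "hodge g ?a lam \<alpha> = 0"
        using False ext_power_negative[OF _ hodge_ext_power[OF a assms(3)]] by simp
      then show ?thesis by (simp add: tens_simps)
    next
      case p: False
      then have "hodge g ?b eta \<omega> = 0"
        using ext_power_negative[OF _ hodge_ext_power[OF b assms(4)]] by simp
      then show ?thesis by (simp add: tens_simps)
    qed
    then show ?thesis unfolding expand by (simp only: if_cancel sum.neutral_const zmul_zero_right)
  qed
qed

lemma additive_pull1: "additive pull1"
  by (simp add: additive_def pull1_def tens_simps)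

lemma fourier_mukai_rat_incl:
  assumes "lattice_basis g lam" "lattice_basis g eta"
  shows "fourier_mukai g lam eta (rat_incl x) = rat_incl (push2 g lam eta
    (kunneth_mult (\<Sum>k\<le>2 * g. chern_divided_power g lam eta k) (pull1 x)))"
  unfolding fourier_mukai_def kunneth_exp_chern rat_map_incl[OF additive_pull1]
    rat_bimap_incl[OF biadditive_kunneth_mult] rat_map_incl[OF additive_push2[OF assms]] ..

theorem theoremA:
  fixes g p q :: nat
    and \<iota> :: "'l::ab_group_add \<Rightarrow> ('n::ab_group_add, real) tensor"
    and lam :: "nat \<Rightarrow> 'l" and eta :: "nat \<Rightarrow> 'n"
  assumes "real_torus g \<iota>"
    and "lattice_basis g lam" and "lattice_basis g eta"
    and "same_orientation g (\<lambda>i. \<iota> (lam i)) (\<lambda>i. eta i \<otimes>\<^sub>Z 1)"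
  shows "\<exists>\<phi>.
      bij_betw \<phi> (trop_coh (int p) (int q) :: ('l zdual, 'n zdual) coh set)
        (trop_coh (int g - int q) (int g - int p) :: ('n, 'l) coh set) \<and>
      (\<forall>x \<in> trop_coh (int p) (int q). \<forall>y \<in> trop_coh (int p) (int q). \<phi> (x + y) = \<phi> x + \<phi> y) \<and>
      (\<forall>x \<in> trop_coh (int p) (int q). fourier_mukai g lam eta (rat_incl x) = rat_incl (\<phi> x))"
proof -
  let ?a = "dual_basis g lam" and ?b = "dual_basis g eta"
  note lam = assms(2) and eta = assms(3)
  note a = lattice_basis_dual_basis[OF lam] and b = lattice_basis_dual_basis[OF eta]
  define e where "e = power_sign (2 * g - p - q)"
  \<comment> \<open>The sign is frozen at its value for the given \<open>p\<close> and
    \<open>q\<close>: the map lives on the whole cohomology, but is compared with the transform in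
    bidegree \<open>(p, q)\<close> only.\<close>
  define \<phi> where "\<phi> x = zmul e (tensor_lift (\<lambda>\<alpha> \<omega>. hodge g ?b eta \<omega> \<otimes>\<^sub>Z hodge g ?a lam \<alpha>) x)" for x
  \<comment> \<open>The inverse stars in swapped order; the sign \<open>e\<close> is its own
    inverse.\<close>
  define \<psi> where "\<psi> y = zmul e (tensor_lift (\<lambda>\<nu> \<mu>. hodge_inv g ?a lam \<mu> \<otimes>\<^sub>Z hodge_inv g ?b eta \<nu>) y)" for y
  have bi: "biadditive (\<lambda>\<alpha> \<omega>. hodge g ?b eta \<omega> \<otimes>\<^sub>Z hodge g ?a lam \<alpha>)"
    by (rule biadditiveI) (simp_all add: additive.add[OF additive_hodge[OF a]] additive.add[OF additive_hodge[OF b]] tens_simps)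
  have bi': "biadditive (\<lambda>\<nu> \<mu>. hodge_inv g ?a lam \<mu> \<otimes>\<^sub>Z hodge_inv g ?b eta \<nu>)"
    by (rule biadditiveI) (simp_all add: additive.add[OF additive_hodge_inv[OF lam]]
        additive.add[OF additive_hodge_inv[OF eta]] tens_simps)
  have \<phi>: "additive \<phi>" and \<psi>: "additive \<psi>"
    unfolding \<phi>_def \<psi>_def
    by (rule additive_comp[OF additive_zmul additive_tensor_lift], rule bi bi')+
  have \<phi>_tens: "\<phi> (\<alpha> \<otimes>\<^sub>Z \<omega>) = zmul e (hodge g ?b eta \<omega> \<otimes>\<^sub>Z hodge g ?a lam \<alpha>)" for \<alpha> \<omega>
    by (simp add: \<phi>_def bi)
  have \<psi>_tens: "\<psi> (\<nu> \<otimes>\<^sub>Z \<mu>) = zmul e (hodge_inv g ?a lam \<mu> \<otimes>\<^sub>Z hodge_inv g ?b eta \<nu>)" for \<nu> \<mu>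
    by (simp add: \<psi>_def bi')
  have ee: "e * e = 1" by (simp add: e_def power_sign_square)
  \<comment> \<open>The two maps are mutually inverse on the whole cohomology. Bijectivity between
    the bidegrees then only requires that each maps one bidegree into the other.\<close>
  have \<psi>\<phi>: "\<psi> (\<phi> x) = x" for x
    by (rule tensor_additive_eqI[OF additive_comp[OF \<psi> \<phi>] additive_id])
      (simp add: \<phi>_tens \<psi>_tens zmul_additive[OF \<psi>] zmul_zmul ee hodge_inv_hodge[OF a lam] hodge_inv_hodge[OF b eta])
  have \<phi>\<psi>: "\<phi> (\<psi> y) = y" for y
    by (rule tensor_additive_eqI[OF additive_comp[OF \<phi> \<psi>] additive_id])
      (simp add: \<phi>_tens \<psi>_tens zmul_additive[OF \<phi>] zmul_zmul ee hodge_hodge_inv[OF a lam] hodge_hodge_inv[OF b eta])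
  have \<phi>_mem: "\<phi> x \<in> trop_coh (int g - int q) (int g - int p)" if "x \<in> trop_coh (int p) (int q)" for x
    unfolding trop_coh_def
  proof (rule additive_group_closure[OF \<phi> _ that[unfolded trop_coh_def]])
    fix s :: "('l zdual, 'n zdual) coh"
    assume "s \<in> {\<alpha> \<otimes>\<^sub>Z \<omega> |\<alpha> \<omega>. \<alpha> \<in> ext_power (int q) \<and> \<omega> \<in> ext_power (int p)}"
    then obtain \<alpha> \<omega> where "s = \<alpha> \<otimes>\<^sub>Z \<omega>" "\<alpha> \<in> ext_power (int q)" "\<omega> \<in> ext_power (int p)" by blast
    then show "\<phi> s \<in> group_closure {\<alpha> \<otimes>\<^sub>Z \<omega> |\<alpha> \<omega>. \<alpha> \<in> ext_power (int g - int p) \<and> \<omega> \<in> ext_power (int g - int q)}"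
      using tens_trop_coh[OF hodge_ext_power[OF b] hodge_ext_power[OF a], of \<omega> "int p" \<alpha> "int q" eta lam]
      by (simp add: \<phi>_tens group_closure_zmul trop_coh_def)
  qed
  have \<psi>_mem: "\<psi> y \<in> trop_coh (int p) (int q)" if "y \<in> trop_coh (int g - int q) (int g - int p)" for y
    unfolding trop_coh_def
  proof (rule additive_group_closure[OF \<psi> _ that[unfolded trop_coh_def]])
    fix s :: "('n, 'l) coh"
    assume "s \<in> {\<alpha> \<otimes>\<^sub>Z \<omega> |\<alpha> \<omega>. \<alpha> \<in> ext_power (int g - int p) \<and> \<omega> \<in> ext_power (int g - int q)}"
    then obtain \<nu> \<mu> where "s = \<nu> \<otimes>\<^sub>Z \<mu>" "\<nu> \<in> ext_power (int g - int p)" "\<mu> \<in> ext_power (int g - int q)" by blast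
    then show "\<psi> s \<in> group_closure {\<alpha> \<otimes>\<^sub>Z \<omega> |\<alpha> \<omega>. \<alpha> \<in> ext_power (int q) \<and> \<omega> \<in> ext_power (int p)}"
      using tens_trop_coh[OF hodge_inv_ext_power[OF lam] hodge_inv_ext_power[OF eta],
          of \<mu> "int g - int q" \<nu> "int g - int p" ?a ?b]
      by (simp add: \<psi>_tens group_closure_zmul trop_coh_def)
  qed
  \<comment> \<open>Additivity reduces the comparison to the generators of the bidegree, where
    \<open>integral_transform_tens\<close> yields exactly the sign \<open>e\<close>.\<close>
  have int: "push2 g lam eta (kunneth_mult (\<Sum>k\<le>2 * g. chern_divided_power g lam eta k) (pull1 x)) = \<phi> x"
    if "x \<in> trop_coh (int p) (int q)" for x
  proof (rule additive_eq_on_group_closure[OF _ \<phi> _ that[unfolded trop_coh_def]])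
    show "additive (\<lambda>x. push2 g lam eta (kunneth_mult (\<Sum>k\<le>2 * g. chern_divided_power g lam eta k) (pull1 x)))"
      by (simp add: additive_def pull1_def tens_simps additive.add[OF additive_push2[OF lam eta]]
          biadditiveD[OF biadditive_kunneth_mult])
  qed (auto simp: integral_transform_tens[OF lam eta] \<phi>_tens e_def)
  show ?thesis
  proof (intro exI[of _ \<phi>] conjI ballI)
    show "bij_betw \<phi> (trop_coh (int p) (int q)) (trop_coh (int g - int q) (int g - int p))"
      by (rule bij_betw_byWitness[of _ \<psi>]) (use \<phi>_mem \<psi>_mem \<psi>\<phi> \<phi>\<psi> in auto)
    show "\<phi> (x + y) = \<phi> x + \<phi> y" for x y by (rule additive.add[OF \<phi>])
    show "fourier_mukai g lam eta (rat_incl x) = rat_incl (\<phi> x)" if "x \<in> trop_coh (int p) (int q)" for x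
      by (simp add: fourier_mukai_rat_incl[OF lam eta] int[OF that])
  qed
qed

end
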